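(* Let $\varphi$ be an MPNL formula. If there exists an $\mathbb{N}$-compass generator $\mathcal{G}=(\mathbb{P}_{\mathbb{D}},\mathcal{L})$ that features $\varphi$, then there exists an $\mathbb{N}$-compass generator $\mathcal{G}'=(\mathbb{P}_{\mathbb{D}'},\mathcal{L}')$ that features $\varphi$ with $|D'|\le\left(2^{3|\varphi|}+2\right)\cdot\left(\frac{|\varphi|^2}{4}+\frac{|\varphi|}{2}+1\right)^{2^{3|\varphi|}}+1$.
   Context: $|\varphi|$ is the length of $\varphi$. MPNL formulae: $\varphi ::= len_{<k} \mid p \mid \neg\varphi \mid \varphi\vee\varphi \mid \lozenge_l\varphi \mid \lozenge_r\varphi$ ($p$ atomic, $k\in\mathbb{N}$), interpreted over intervals $[x,y]$, $x\le y$: $len_{<k}$ holds iff $|x-y|<k$; $\lozenge_l\psi$ holds at $[x,y]$ iff $\psi$ holds at some $[z,x]$; $\lozenge_r\psi$ holds at $[x,y]$ iff $\psi$ holds at some $[y,z]$. $Cl(\varphi)$: subformulae of $\varphi$ and their negations (identifying $\neg\neg\alpha$ with $\alpha$, $\neg\lozenge_r\alpha$ with $\Box_r\neg\alpha$, etc.). A $\varphi$-atom is a non-empty $F\subseteq Cl(\varphi)$ with: $\alpha\in F$ iff $\neg\alpha\notin F$; $\alpha\vee\beta\in F$ iff $\alpha\in F$ or $\beta\in F$; for $k<k'$, $len_{<k}\in F$ implies $len_{<k'}\in F$. $\mathcal{A}_\varphi$ is the set of atoms. $Obs_r(F)=\{\psi\in F:\lozenge_r\psi\in Cl(\varphi)\}$,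 $Obs_l(F)=\{\psi\in F:\lozenge_l\psi\in Cl(\varphi)\}$, $Req_r(F)=\{\psi:\lozenge_r\psi\in F\}$, $Req_l(F)=\{\psi:\lozenge_l\psi\in F\}$; $F\,R\,G$ iff $Obs_r(G)\subseteq Req_r(F)$ and $Obs_l(F)\subseteq Req_l(G)$. A compass $\varphi$-structure over $D$ is $(\mathbb{P}_{\mathbb{D}},\mathcal{L})$ with $\mathbb{P}_{\mathbb{D}}=\{(x,y)\in D^2:x\le y\}$ and $\mathcal{L}$ assigning atoms to points such that: if $y=x'$ then $\mathcal{L}(x,y)\,R\,\mathcal{L}(x',y')$; and $len_{<k}\in\mathcal{L}(x,y)$ implies $y-x<k$. It features $\psi$ if $\psi\in\mathcal{L}(x,y)$ for some point. The $\lozenge_l$-requests of a point $(x,y)$ are fulfilled if each $\psi\in Req_l(\mathcal{L}(x,y))$ occurs in some $\mathcal{L}(x',x)$. $k_\varphi$ is the maximum $k$ occurring in some $len_{<k}$ in $\varphi$ ($0$ if none). Marking: $\mathcal{M}(x,y)=(F,\Psi,h)$ with $F=\mathcal{L}(x,y)$, $\Psi=\{\psi\in Req_r(\mathcal{L}(x,x)):\psi\notin\mathcal{L}(x,y')\text{ for all }x\le y'\le y\}$, $h=\min(y-x,k_\varphi)$. Marked atoms are triples in $\mathcal{A}^{\mathcal{M}}_\varphi\subseteq\mathcal{A}_\varphi\times2^{Cl(\varphi)}\times\{0,\ldots,k_\varphi\}$. Horizontal configuration: $\mathcal{C}_y(F,\Psi,h)=|\{x:\mathcal{M}(x,y)=(F,\Psi,h)\}|$.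 An $\mathbb{N}$-compass generator for $\varphi$ is a finite compass $\varphi$-structure over $D=\{0,\ldots,y_{max}\}$ which features $\varphi$ and satisfies: (1) all $\lozenge_l$-requests of every point are fulfilled; (2) there exists $y_{inf}\in D$ with $y_{max}-y_{inf}\ge k_\varphi$ such that (a) for every marked atom $(F,\Psi,h)$, if $\mathcal{C}_{y_{max}}(F,\Psi,h)>0$ then $\mathcal{C}_{y_{inf}}(F,\Psi,h)>0$, and (b) for every $0\le x\le y_{inf}$, $\mathcal{M}(x,y_{max})$ has the form $(F,\emptyset,h)$. *)

theory Defs
  imports Complex_Main "HOL-Library.Log_Nat"
begin

datatype 'p mpnl =
    Len nat
  | Prop 'p
  | Neg "'p mpnl"
  | Or "'p mpnl" "'p mpnl"
  | DiaL "'p mpnl"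
  | DiaR "'p mpnl"

abbreviation BoxL :: "'p mpnl \<Rightarrow> 'p mpnl" where
  "BoxL \<alpha> \<equiv> Neg (DiaL (Neg \<alpha>))"

abbreviation BoxR :: "'p mpnl \<Rightarrow> 'p mpnl" where
  "BoxR \<alpha> \<equiv> Neg (DiaR (Neg \<alpha>))"

text \<open>Length is the number of symbols of the formula. The constant \<^term>\<open>k\<close> of a metric atom
  is written in binary, so it contributes its number of binary digits (\<^term>\<open>0::nat\<close> has one
  digit, whereas \<^term>\<open>floorlog 2 0 = 0\<close>).\<close>

primrec fm_length :: "'p mpnl \<Rightarrow> nat" where
  "fm_length (Len k) = 1 + max 1 (floorlog 2 k)"
| "fm_length (Prop p) = 1"
| "fm_length (Neg \<alpha>) = 1 + fm_length \<alpha>"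
| "fm_length (Or \<alpha> \<beta>) = 1 + fm_length \<alpha> + fm_length \<beta>"
| "fm_length (DiaL \<alpha>) = 1 + fm_length \<alpha>"
| "fm_length (DiaR \<alpha>) = 1 + fm_length \<alpha>"

primrec subfms :: "'p mpnl \<Rightarrow> 'p mpnl set" where
  "subfms (Len k) = {Len k}"
| "subfms (Prop p) = {Prop p}"
| "subfms (Neg \<alpha>) = insert (Neg \<alpha>) (subfms \<alpha>)"
| "subfms (Or \<alpha> \<beta>) = insert (Or \<alpha> \<beta>) (subfms \<alpha> \<union> subfms \<beta>)"
| "subfms (DiaL \<alpha>) = insert (DiaL \<alpha>) (subfms \<alpha>)"
| "subfms (DiaR \<alpha>) = insert (DiaR \<alpha>) (subfms \<alpha>)"

definition k_max :: "'p mpnl \<Rightarrow> nat" where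
  "k_max \<phi> = Max (insert 0 {k. Len k \<in> subfms \<phi>})"

text \<open>Formulae are identified modulo \<open>\<not>\<not>\<alpha> = \<alpha>\<close>, at every depth. \<^term>\<open>nf\<close> picks the
  representative without double negations and \<^term>\<open>cneg\<close> is negation on representatives.
  Since boxes are abbreviations, this also identifies \<open>\<not>\<diamond>\<alpha>\<close> with \<open>\<box>\<not>\<alpha>\<close>; see the lemmas
  \<open>nf_BoxL\<close> and \<open>nf_BoxR\<close>.\<close>

fun cneg :: "'p mpnl \<Rightarrow> 'p mpnl" where
  "cneg (Neg \<alpha>) = \<alpha>"
| "cneg \<alpha> = Neg \<alpha>"

primrec nf :: "'p mpnl \<Rightarrow> 'p mpnl" where
  "nf (Len k) = Len k"
| "nf (Prop p) = Prop p"
| "nf (Neg \<alpha>) = cneg (nf \<alpha>)"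
| "nf (Or \<alpha> \<beta>) = Or (nf \<alpha>) (nf \<beta>)"
| "nf (DiaL \<alpha>) = DiaL (nf \<alpha>)"
| "nf (DiaR \<alpha>) = DiaR (nf \<alpha>)"

lemma cneg_cneg_nf: "cneg (cneg (nf \<alpha>)) = nf \<alpha>"
  by (induction \<alpha>) simp_all

lemma nf_BoxL: "nf (BoxL (Neg \<alpha>)) = nf (Neg (DiaL \<alpha>))"
  by (simp add: cneg_cneg_nf)

lemma nf_BoxR: "nf (BoxR (Neg \<alpha>)) = nf (Neg (DiaR \<alpha>))"
  by (simp add: cneg_cneg_nf)

definition Cl :: "'p mpnl \<Rightarrow> 'p mpnl set" where
  "Cl \<phi> = nf ` (subfms \<phi> \<union> Neg ` subfms \<phi>)"

definition atoms :: "'p mpnl \<Rightarrow> 'p mpnl set set" where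
  "atoms \<phi> = {F. F \<noteq> {} \<and> F \<subseteq> Cl \<phi> \<and>
     (\<forall>\<alpha>\<in>Cl \<phi>. \<alpha> \<in> F \<longleftrightarrow> cneg \<alpha> \<notin> F) \<and>
     (\<forall>\<alpha> \<beta>. Or \<alpha> \<beta> \<in> Cl \<phi> \<longrightarrow> (Or \<alpha> \<beta> \<in> F \<longleftrightarrow> \<alpha> \<in> F \<or> \<beta> \<in> F)) \<and>
     (\<forall>k k'. k < k' \<longrightarrow> Len k' \<in> Cl \<phi> \<longrightarrow> Len k \<in> F \<longrightarrow> Len k' \<in> F)}"

definition Obs_r :: "'p mpnl \<Rightarrow> 'p mpnl set \<Rightarrow> 'p mpnl set" where
  "Obs_r \<phi> F = {\<psi>\<in>F. DiaR \<psi> \<in> Cl \<phi>}"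

definition Obs_l :: "'p mpnl \<Rightarrow> 'p mpnl set \<Rightarrow> 'p mpnl set" where
  "Obs_l \<phi> F = {\<psi>\<in>F. DiaL \<psi> \<in> Cl \<phi>}"

definition Req_r :: "'p mpnl set \<Rightarrow> 'p mpnl set" where
  "Req_r F = {\<psi>. DiaR \<psi> \<in> F}"

definition Req_l :: "'p mpnl set \<Rightarrow> 'p mpnl set" where
  "Req_l F = {\<psi>. DiaL \<psi> \<in> F}"

definition atom_rel :: "'p mpnl \<Rightarrow> 'p mpnl set \<Rightarrow> 'p mpnl set \<Rightarrow> bool" where
  "atom_rel \<phi> F G \<longleftrightarrow> Obs_r \<phi> G \<subseteq> Req_r F \<and> Obs_l \<phi> F \<subseteq> Req_l G"

definition points :: "nat set \<Rightarrow> (nat \<times> nat) set" where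
  "points D = {(x, y). x \<in> D \<and> y \<in> D \<and> x \<le> y}"

text \<open>A structure over \<^term>\<open>D\<close> is given by \<^term>\<open>D\<close> and a labelling, of which only the values
  on \<^term>\<open>points D\<close> matter.\<close>

type_synonym 'p labelling = "nat \<times> nat \<Rightarrow> 'p mpnl set"

definition compass_structure :: "'p mpnl \<Rightarrow> nat set \<Rightarrow> 'p labelling \<Rightarrow> bool" where
  "compass_structure \<phi> D L \<longleftrightarrow>
     (\<forall>p\<in>points D. L p \<in> atoms \<phi>) \<and>
     (\<forall>x y x' y'. (x, y) \<in> points D \<longrightarrow> (x', y') \<in> points D \<longrightarrow> y = x' \<longrightarrow>
        atom_rel \<phi> (L (x, y)) (L (x', y'))) \<and>
     (\<forall>x y k. (x, y) \<in> points D \<longrightarrow> Len k \<in> L (x, y) \<longrightarrow> y - x < k)"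

definition features :: "nat set \<Rightarrow> 'p labelling \<Rightarrow> 'p mpnl \<Rightarrow> bool" where
  "features D L \<psi> \<longleftrightarrow> (\<exists>p\<in>points D. nf \<psi> \<in> L p)"

definition left_fulfilled :: "nat set \<Rightarrow> 'p labelling \<Rightarrow> nat \<Rightarrow> nat \<Rightarrow> bool" where
  "left_fulfilled D L x y \<longleftrightarrow>
     (\<forall>\<psi>\<in>Req_l (L (x, y)). \<exists>x'. (x', x) \<in> points D \<and> \<psi> \<in> L (x', x))"

type_synonym 'p marked = "'p mpnl set \<times> 'p mpnl set \<times> nat"

definition marking :: "'p mpnl \<Rightarrow> nat set \<Rightarrow> 'p labelling \<Rightarrow> nat \<Rightarrow> nat \<Rightarrow> 'p marked" where
  "marking \<phi> D L x y =
     (L (x, y),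
      {\<psi>\<in>Req_r (L (x, x)). \<forall>y'\<in>D. x \<le> y' \<longrightarrow> y' \<le> y \<longrightarrow> \<psi> \<notin> L (x, y')},
      min (y - x) (k_max \<phi>))"

definition marked_atoms :: "'p mpnl \<Rightarrow> 'p marked set" where
  "marked_atoms \<phi> = atoms \<phi> \<times> Pow (Cl \<phi>) \<times> {0..k_max \<phi>}"

definition config :: "'p mpnl \<Rightarrow> nat set \<Rightarrow> 'p labelling \<Rightarrow> nat \<Rightarrow> 'p marked \<Rightarrow> nat" where
  "config \<phi> D L y m = card {x. (x, y) \<in> points D \<and> marking \<phi> D L x y = m}"

definition N_compass_generator :: "'p mpnl \<Rightarrow> nat set \<Rightarrow> 'p labelling \<Rightarrow> bool" where
  "N_compass_generator \<phi> D L \<longleftrightarrow>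
     (\<exists>y_max. D = {0..y_max} \<and>
        compass_structure \<phi> D L \<and>
        features D L \<phi> \<and>
        (\<forall>x y. (x, y) \<in> points D \<longrightarrow> left_fulfilled D L x y) \<and>
        (\<exists>y_inf\<in>D. y_max - y_inf \<ge> k_max \<phi> \<and>
           (\<forall>m\<in>marked_atoms \<phi>. config \<phi> D L y_max m > 0 \<longrightarrow> config \<phi> D L y_inf m > 0) \<and>
           (\<forall>x. 0 \<le> x \<and> x \<le> y_inf \<longrightarrow> (\<exists>F h. marking \<phi> D L x y_max = (F, {}, h)))))"

end

theory Submission
  imports Defs "HOL-Library.FuncSet"
begin

text \<open>Take a generator with the least number of rows. Call the type of a column \<open>x\<close> at row \<open>y\<close> its
  label, the fate of each formula in the column (not requested, fulfilled, fulfilled later, never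
  fulfilled), and \<open>min (y - x) k\<close>. If rows \<open>y1 < y2\<close> have equally many columns of each type, up to a
  cap, then the rows between them can be cut out: above row \<open>y1\<close> each old column follows columns of
  the same type at \<open>y2\<close>, and the column followed may change from row to row, so that polynomially
  many columns per type suffice to serve all left requests of all rows above. Below \<open>y_inf\<close> the
  cap also pays for representatives of the markings of the top row, but there no
  request stays unfulfilled, so there are only three fates. Above \<open>y_inf + k\<close> there are four fates
  but no representatives. Hence in a minimal generator the capped type counts are injective on a
  few blocks of rows. Cutting rows only shortens intervals, which is harmless because
  \<open>Len k\<close> in a label constrains the length from above only.\<close>

section \<open>Size of the closure\<close>

lemma nf_not_double_Neg: "nf \<beta> \<noteq> Neg (Neg \<gamma>)"
proof
  assume "nf \<beta> = Neg (Neg \<gamma>)"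
  then have "\<gamma> = Neg (Neg \<gamma>)"
    using cneg_cneg_nf[of \<beta>] by simp
  then have "size \<gamma> = size (Neg (Neg \<gamma>))"
    by (rule arg_cong)
  then show False by simp
qed

lemma cneg_eq_cases: "cneg \<alpha> = \<beta> \<Longrightarrow> \<alpha> = Neg \<beta> \<or> \<beta> = Neg \<alpha>"
  by (cases \<alpha>) auto

text \<open>Both signs appear in the hypothesis because passing under a negation flips the sign;
  with a single sign the induction would not close.\<close>

lemma nf_eq_DiaR:
  "nf \<beta> = DiaR \<psi> \<or> nf \<beta> = Neg (DiaR \<psi>) \<Longrightarrow> \<exists>\<alpha>. DiaR \<alpha> \<in> subfms \<beta> \<and> \<psi> = nf \<alpha>"
proof (induction \<beta>)
  case (Neg \<beta>)
  then have "nf \<beta> = DiaR \<psi> \<or> nf \<beta> = Neg (DiaR \<psi>)"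
    using nf_not_double_Neg by (auto dest!: cneg_eq_cases)
  with Neg.IH show ?case by auto
qed auto

lemma nf_eq_DiaL:
  "nf \<beta> = DiaL \<psi> \<or> nf \<beta> = Neg (DiaL \<psi>) \<Longrightarrow> \<exists>\<alpha>. DiaL \<alpha> \<in> subfms \<beta> \<and> \<psi> = nf \<alpha>"
proof (induction \<beta>)
  case (Neg \<beta>)
  then have "nf \<beta> = DiaL \<psi> \<or> nf \<beta> = Neg (DiaL \<psi>)"
    using nf_not_double_Neg by (auto dest!: cneg_eq_cases)
  with Neg.IH show ?case by auto
qed auto

lemma nf_eq_Len:
  "nf \<beta> = Len k \<or> nf \<beta> = Neg (Len k) \<Longrightarrow> Len k \<in> subfms \<beta>"
proof (induction \<beta>)
  case (Neg \<beta>)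
  then have "nf \<beta> = Len k \<or> nf \<beta> = Neg (Len k)"
    using nf_not_double_Neg by (auto dest!: cneg_eq_cases)
  with Neg.IH show ?case by auto
qed auto

lemma subfms_trans: "\<beta> \<in> subfms \<phi> \<Longrightarrow> subfms \<beta> \<subseteq> subfms \<phi>"
  by (induction \<phi>) auto

lemma finite_subfms [simp]: "finite (subfms \<phi>)"
  by (induction \<phi>) auto

lemma Cl_cases:
  assumes "\<alpha> \<in> Cl \<phi>"
  obtains \<beta> where "\<beta> \<in> subfms \<phi>" "\<alpha> = nf \<beta> \<or> \<alpha> = cneg (nf \<beta>)"
  using assms by (auto simp: Cl_def)

text \<open>Request sets of labels lie in sets of this kind, so statuses and pending sets are
  counted over the diamonds only instead of over all of \<open>Cl \<phi>\<close>.\<close>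

definition dia_r :: "'p mpnl \<Rightarrow> 'p mpnl set" where
  "dia_r \<phi> = {\<psi>. DiaR \<psi> \<in> Cl \<phi>}"

definition dia_l :: "'p mpnl \<Rightarrow> 'p mpnl set" where
  "dia_l \<phi> = {\<psi>. DiaL \<psi> \<in> Cl \<phi>}"

lemma dia_r_subset: "dia_r \<phi> \<subseteq> nf ` {\<alpha>. DiaR \<alpha> \<in> subfms \<phi>}"
proof
  fix \<psi> assume "\<psi> \<in> dia_r \<phi>"
  then obtain \<beta> where \<beta>: "\<beta> \<in> subfms \<phi>" "DiaR \<psi> = nf \<beta> \<or> DiaR \<psi> = cneg (nf \<beta>)"
    unfolding dia_r_def by (auto elim: Cl_cases)
  then have "nf \<beta> = DiaR \<psi> \<or> nf \<beta> = Neg (DiaR \<psi>)"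
    by (auto dest!: sym[of "DiaR \<psi>"] cneg_eq_cases)
  with nf_eq_DiaR obtain \<alpha> where "DiaR \<alpha> \<in> subfms \<beta>" "\<psi> = nf \<alpha>" by blast
  with \<beta>(1) show "\<psi> \<in> nf ` {\<alpha>. DiaR \<alpha> \<in> subfms \<phi>}"
    using subfms_trans by blast
qed

lemma dia_l_subset: "dia_l \<phi> \<subseteq> nf ` {\<alpha>. DiaL \<alpha> \<in> subfms \<phi>}"
proof
  fix \<psi> assume "\<psi> \<in> dia_l \<phi>"
  then obtain \<beta> where \<beta>: "\<beta> \<in> subfms \<phi>" "DiaL \<psi> = nf \<beta> \<or> DiaL \<psi> = cneg (nf \<beta>)"
    unfolding dia_l_def by (auto elim: Cl_cases)
  then have "nf \<beta> = DiaL \<psi> \<or> nf \<beta> = Neg (DiaL \<psi>)"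
    by (auto dest!: sym[of "DiaL \<psi>"] cneg_eq_cases)
  with nf_eq_DiaL obtain \<alpha> where "DiaL \<alpha> \<in> subfms \<beta>" "\<psi> = nf \<alpha>" by blast
  with \<beta>(1) show "\<psi> \<in> nf ` {\<alpha>. DiaL \<alpha> \<in> subfms \<phi>}"
    using subfms_trans by blast
qed

lemma finite_DiaR_subfms [simp]: "finite {\<alpha>. DiaR \<alpha> \<in> subfms \<phi>}"
  using finite_vimageI[OF finite_subfms[of \<phi>], of DiaR] by (simp add: vimage_def inj_on_def)

lemma finite_DiaL_subfms [simp]: "finite {\<alpha>. DiaL \<alpha> \<in> subfms \<phi>}"
  using finite_vimageI[OF finite_subfms[of \<phi>], of DiaL] by (simp add: vimage_def inj_on_def)

lemma finite_Len_subfms [simp]: "finite {k. Len k \<in> subfms \<phi>}"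
  using finite_vimageI[OF finite_subfms[of \<phi>], of Len] by (simp add: vimage_def inj_on_def)

lemma finite_dia_r [simp]: "finite (dia_r \<phi>)"
  using dia_r_subset by (rule finite_subset) simp

lemma finite_dia_l [simp]: "finite (dia_l \<phi>)"
  using dia_l_subset by (rule finite_subset) simp

lemma Len_in_Cl_le_k_max:
  assumes "Len k \<in> Cl \<phi>"
  shows "k \<le> k_max \<phi>"
proof -
  obtain \<beta> where \<beta>: "\<beta> \<in> subfms \<phi>" "Len k = nf \<beta> \<or> Len k = cneg (nf \<beta>)"
    using assms by (auto elim: Cl_cases)
  then have "nf \<beta> = Len k \<or> nf \<beta> = Neg (Len k)"
    by (auto dest!: sym[of "Len k"] cneg_eq_cases)
  with \<beta>(1) have "Len k \<in> subfms \<phi>"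
    using nf_eq_Len subfms_trans by blast
  then show ?thesis
    unfolding k_max_def by (intro Max_ge) auto
qed

section \<open>Counting diamonds, subformulae and atoms against the length\<close>

text \<open>Each diamond subformula costs a symbol of its own, and every formula has a leaf besides.
  The strictness pays later for the \<open>+ 1\<close> in \<open>card (dia_r \<phi>) + 1\<close> and
  for the exponent \<open>fm_length \<phi> - 1\<close>.\<close>

lemma card_diamonds_less_fm_length:
  "card {\<alpha>. DiaL \<alpha> \<in> subfms \<phi>} + card {\<alpha>. DiaR \<alpha> \<in> subfms \<phi>} < fm_length \<phi>"
proof (induction \<phi>)
  case (Or \<phi>1 \<phi>2)
  have "card {\<alpha>. DiaL \<alpha> \<in> subfms (Or \<phi>1 \<phi>2)}
      \<le> card {\<alpha>. DiaL \<alpha> \<in> subfms \<phi>1} + card {\<alpha>. DiaL \<alpha> \<in> subfms \<phi>2}"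
    by (simp add: Collect_disj_eq card_Un_le)
  moreover have "card {\<alpha>. DiaR \<alpha> \<in> subfms (Or \<phi>1 \<phi>2)}
      \<le> card {\<alpha>. DiaR \<alpha> \<in> subfms \<phi>1} + card {\<alpha>. DiaR \<alpha> \<in> subfms \<phi>2}"
    by (simp add: Collect_disj_eq card_Un_le)
  ultimately show ?case using Or by simp
next
  case (DiaL \<phi>)
  have "{\<alpha>. DiaL \<alpha> \<in> subfms (DiaL \<phi>)} = insert \<phi> {\<alpha>. DiaL \<alpha> \<in> subfms \<phi>}" by auto
  then have "card {\<alpha>. DiaL \<alpha> \<in> subfms (DiaL \<phi>)} \<le> Suc (card {\<alpha>. DiaL \<alpha> \<in> subfms \<phi>})"
    by (simp add: card_insert_if)
  then show ?case using DiaL by simp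
next
  case (DiaR \<phi>)
  have "{\<alpha>. DiaR \<alpha> \<in> subfms (DiaR \<phi>)} = insert \<phi> {\<alpha>. DiaR \<alpha> \<in> subfms \<phi>}" by auto
  then have "card {\<alpha>. DiaR \<alpha> \<in> subfms (DiaR \<phi>)} \<le> Suc (card {\<alpha>. DiaR \<alpha> \<in> subfms \<phi>})"
    by (simp add: card_insert_if)
  then show ?case using DiaR by simp
qed auto

lemma card_dia_less_fm_length: "card (dia_l \<phi>) + card (dia_r \<phi>) < fm_length \<phi>"
proof -
  have "card (dia_l \<phi>) \<le> card {\<alpha>. DiaL \<alpha> \<in> subfms \<phi>}"
    using surj_card_le[OF _ dia_l_subset] by simp
  moreover have "card (dia_r \<phi>) \<le> card {\<alpha>. DiaR \<alpha> \<in> subfms \<phi>}"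
    using surj_card_le[OF _ dia_r_subset] by simp
  ultimately show ?thesis using card_diamonds_less_fm_length[of \<phi>] by linarith
qed

lemma card_subfms_le: "card (subfms \<phi>) \<le> fm_length \<phi>"
proof (induction \<phi>)
  case (Or \<phi>1 \<phi>2)
  then show ?case
    using card_Un_le[of "subfms \<phi>1" "subfms \<phi>2"]
    by (auto simp: card_insert_if)
qed (auto simp: card_insert_if)

text \<open>A subformula is charged one symbol of the length and a metric atom also its digits; in a
  disjunction the digits are charged to a side that contains \<open>Len k\<close>.\<close>

lemma card_subfms_Len_le:
  "Len k \<in> subfms \<phi> \<Longrightarrow> card (subfms \<phi>) + floorlog 2 k \<le> fm_length \<phi>"
proof (induction \<phi>)
  case (Or \<phi>1 \<phi>2)
  have "card (subfms (Or \<phi>1 \<phi>2)) \<le> 1 + card (subfms \<phi>1) + card (subfms \<phi>2)"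
    using card_Un_le[of "subfms \<phi>1" "subfms \<phi>2"] by (auto simp: card_insert_if)
  moreover have "card (subfms \<phi>1) + floorlog 2 k \<le> fm_length \<phi>1
      \<or> card (subfms \<phi>2) + floorlog 2 k \<le> fm_length \<phi>2"
    using Or by auto
  ultimately show ?case
    using card_subfms_le[of \<phi>1] card_subfms_le[of \<phi>2] by auto
qed (auto simp: card_insert_if)

text \<open>Here \<open>j\<close> is \<open>floorlog 2 (k_max \<phi>)\<close>, charged separately
  from the subformulae, so that \<open>2 ^ card (subfms \<phi>)\<close> choices of atoms and
  \<open>2 ^ j\<close> truncated heights multiply to at most
  \<open>2 ^ fm_length \<phi>\<close>.\<close>

lemma k_max_less_power:
  "\<exists>j. card (subfms \<phi>) + j \<le> fm_length \<phi> \<and> k_max \<phi> < 2 ^ j"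
proof (cases "k_max \<phi> = 0")
  case True
  then show ?thesis using card_subfms_le[of \<phi>] by (intro exI[of _ 0]) simp
next
  case False
  have "k_max \<phi> \<in> insert 0 {k. Len k \<in> subfms \<phi>}"
    unfolding k_max_def by (rule Max_in) auto
  with False have "Len (k_max \<phi>) \<in> subfms \<phi>" by simp
  moreover have "k_max \<phi> < 2 ^ floorlog 2 (k_max \<phi>)"
    using floorlog_bounds[of "k_max \<phi>" 2] False by simp
  ultimately show ?thesis using card_subfms_Len_le by blast
qed

text \<open>An atom decides each subformula, and its remaining members are negations of subformulae
  whose membership is forced by that decision.\<close>

lemma inj_on_atoms_subfms: "inj_on (\<lambda>F. {\<beta> \<in> subfms \<phi>. nf \<beta> \<in> F}) (atoms \<phi>)"
proof (rule inj_onI)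
  have sub: "F \<subseteq> G" if F: "F \<in> atoms \<phi>" and G: "G \<in> atoms \<phi>"
    and eq: "{\<beta> \<in> subfms \<phi>. nf \<beta> \<in> F} = {\<beta> \<in> subfms \<phi>. nf \<beta> \<in> G}" for F G
  proof
    fix \<alpha> assume \<alpha>: "\<alpha> \<in> F"
    then have cl: "\<alpha> \<in> Cl \<phi>" using F by (auto simp: atoms_def)
    then obtain \<beta> where \<beta>: "\<beta> \<in> subfms \<phi>" "\<alpha> = nf \<beta> \<or> \<alpha> = cneg (nf \<beta>)"
      by (rule Cl_cases)
    have dec: "\<alpha> \<in> F \<longleftrightarrow> cneg \<alpha> \<notin> F" "\<alpha> \<in> G \<longleftrightarrow> cneg \<alpha> \<notin> G"
      using F G cl by (simp_all add: atoms_def)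
    have same: "nf \<beta> \<in> F \<longleftrightarrow> nf \<beta> \<in> G" using eq \<beta>(1) by blast
    from \<beta>(2) show "\<alpha> \<in> G"
    proof
      assume "\<alpha> = nf \<beta>"
      then show ?thesis using same \<alpha> by simp
    next
      assume "\<alpha> = cneg (nf \<beta>)"
      then show ?thesis using same \<alpha> dec cneg_cneg_nf[of \<beta>] by simp
    qed
  qed
  fix F G assume "F \<in> atoms \<phi>" "G \<in> atoms \<phi>"
    "{\<beta> \<in> subfms \<phi>. nf \<beta> \<in> F} = {\<beta> \<in> subfms \<phi>. nf \<beta> \<in> G}"
  then show "F = G" using sub[of F G] sub[of G F] by auto
qed

lemma finite_atoms [simp]: "finite (atoms \<phi>)"
  by (rule inj_on_finite[OF inj_on_atoms_subfms, where B = "Pow (subfms \<phi>)"]) auto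

lemma card_atoms_le: "card (atoms \<phi>) \<le> 2 ^ card (subfms \<phi>)"
  using card_inj_on_le[OF inj_on_atoms_subfms, where B = "Pow (subfms \<phi>)"]
  by (auto simp: card_Pow)

lemma card_atoms_k_max_le: "card (atoms \<phi>) * Suc (k_max \<phi>) \<le> 2 ^ fm_length \<phi>"
proof -
  obtain j where j: "card (subfms \<phi>) + j \<le> fm_length \<phi>" "k_max \<phi> < 2 ^ j"
    using k_max_less_power by blast
  have "card (atoms \<phi>) * Suc (k_max \<phi>) \<le> 2 ^ card (subfms \<phi>) * 2 ^ j"
    using card_atoms_le j(2) by (intro mult_le_mono) auto
  also have "\<dots> = 2 ^ (card (subfms \<phi>) + j)" by (simp add: power_add)
  also have "\<dots> \<le> 2 ^ fm_length \<phi>" using j(1) by (intro power_increasing) auto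
  finally show ?thesis .
qed

section \<open>Rerouting columns\<close>

lemma ex_function_covering:
  assumes "finite B" "finite V" "card V \<le> card B"
  shows "\<exists>e. V \<subseteq> e ` B \<and> e ` B \<subseteq> insert b V"
proof -
  obtain i where i: "inj_on i V" "i ` V \<subseteq> B"
    using card_le_inj[OF assms(2,1,3)] by auto
  let ?e = "\<lambda>x. if x \<in> i ` V then the_inv_into V i x else b"
  have "v \<in> ?e ` B" if "v \<in> V" for v
    by (rule image_eqI[of _ _ "i v"]) (use i that in \<open>auto simp: the_inv_into_f_f\<close>)
  moreover have "?e x \<in> insert b V" for x
    using i(1) by (auto simp: the_inv_into_f_f)
  ultimately show ?thesis by (intro exI[of _ ?e]) blast
qed

text \<open>The columns of \<open>A\<close> are to follow columns of \<open>A'\<close>. If \<open>A\<close> is large, most of its members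
  follow one fixed column \<open>b\<close>; in the rows where \<open>b\<close> is not needed by them (those outside \<open>Z b\<close>)
  they are free to visit the witnesses \<open>V y\<close> of that row. The witnesses of the few rows in
  \<open>Z b\<close>, and \<open>W\<close>, are followed permanently by dedicated columns.\<close>

lemma ex_rerouting:
  fixes A A' W :: "nat set" and V :: "nat \<Rightarrow> nat set" and Z :: "nat \<Rightarrow> nat set"
  assumes fin: "finite A" "finite A'" and W: "W \<subseteq> A'"
    and V: "\<And>y. V y \<subseteq> A'" "\<And>y. card (V y) \<le> l"
    and Z: "\<And>b. b \<in> A' \<Longrightarrow> finite (Z b)" "\<And>b. b \<in> A' \<Longrightarrow> card (Z b) \<le> r"
    and eq: "min c (card A) = min c (card A')"
    and c: "card W + l * (r + 1) < c"
  shows "\<exists>g. (\<forall>y. \<forall>x\<in>A. g y x \<in> A') \<and> (\<forall>w\<in>W. \<exists>x\<in>A. \<forall>y. g y x = w) \<and>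
    (\<forall>y. V y \<subseteq> g y ` A) \<and> (\<forall>x\<in>A. \<exists>b\<in>A'. \<forall>y\<in>Z b. g y x = b)"
proof (cases "card A < c")
  case True
  then have "card A = card A'" using eq by auto
  then obtain h where h: "bij_betw h A A'"
    using fin finite_same_card_bij by blast
  then have hA: "h ` A = A'" by (simp add: bij_betw_def)
  show ?thesis
  proof (intro exI[of _ "\<lambda>_. h"] conjI ballI allI)
    fix w assume "w \<in> W"
    then have "w \<in> h ` A" using W hA by blast
    then show "\<exists>x\<in>A. \<forall>y::nat. h x = w" by auto
  qed (use V(1) hA in auto)
next
  case False
  then have cA: "c \<le> card A" "c \<le> card A'" using eq by auto
  then have "A' \<noteq> {}" using c by auto
  then obtain b where b: "b \<in> A'" by blast
  define U where "U = W \<union> (\<Union>y\<in>Z b. V y)"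
  have U: "U \<subseteq> A'" using W V(1) by (auto simp: U_def)
  have finU: "finite U" using U fin(2) by (rule finite_subset)
  have "card (\<Union>y\<in>Z b. V y) \<le> (\<Sum>y\<in>Z b. card (V y))"
    using Z(1)[OF b] by (rule card_UN_le)
  also have "\<dots> \<le> (\<Sum>y\<in>Z b. l)" using V(2) by (intro sum_mono) auto
  also have "\<dots> \<le> r * l" using Z(2)[OF b] by simp
  finally have cU: "card U \<le> card W + r * l"
    unfolding U_def using card_Un_le[of W "\<Union>y\<in>Z b. V y"] by linarith
  \<comment> \<open>The cap is chosen so that, after one column is dedicated to each member of
    \<open>U\<close>, at least \<open>l\<close> columns remain free for the witnesses of a
    row.\<close>
  then have cUA: "card U + l < card A" using c cA(1) by (simp add: algebra_simps)
  then obtain A1 where A1: "A1 \<subseteq> A" "card A1 = card U"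
    using obtain_subset_with_card_n[of "card U" A] by auto
  have finA1: "finite A1" using A1(1) fin(1) by (rule finite_subset)
  obtain h where h: "bij_betw h A1 U"
    using finite_same_card_bij[OF finA1 finU A1(2)] by blast
  have hA1: "h ` A1 = U" using h by (simp add: bij_betw_def)
  define A2 where "A2 = A - A1"
  have "l \<le> card A2"
    unfolding A2_def using card_Diff_subset[OF finA1 A1(1)] A1(2) cUA by simp
  then have "\<exists>e. V y \<subseteq> e ` A2 \<and> e ` A2 \<subseteq> insert b (V y)" for y
    using V[of y] fin by (intro ex_function_covering) (auto simp: A2_def intro: finite_subset)
  then obtain e where e: "\<And>y. V y \<subseteq> e y ` A2" "\<And>y. e y ` A2 \<subseteq> insert b (V y)"
    by metis
  define g where "g y x = (if x \<in> A1 then h x else if y \<in> Z b then b else e y x)" for y x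
  have "g y x \<in> A'" if "x \<in> A" for y x
    using that hA1 U b e(2)[of y] V(1)[of y] by (auto simp: g_def A2_def)
  moreover have "\<exists>x\<in>A. \<forall>y. g y x = w" if "w \<in> W" for w
  proof -
    have "w \<in> h ` A1" using that hA1 by (auto simp: U_def)
    then show ?thesis using A1(1) by (auto simp: g_def)
  qed
  moreover have "V y \<subseteq> g y ` A" for y
  proof (cases "y \<in> Z b")
    case True
    then have "V y \<subseteq> h ` A1" using hA1 by (auto simp: U_def)
    also have "h ` A1 = g y ` A1" by (auto simp: g_def)
    finally show ?thesis using A1(1) by blast
  next
    case False
    then have "e y ` A2 = g y ` A2" by (auto simp: g_def A2_def)
    then show ?thesis using e(1)[of y] by (auto simp: A2_def)
  qed
  moreover have "\<exists>b\<in>A'. \<forall>y\<in>Z b. g y x = b" if "x \<in> A" for x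
  proof (cases "x \<in> A1")
    case True
    then show ?thesis using hA1 U by (intro bexI[of _ "h x"]) (auto simp: g_def)
  next
    case False
    then show ?thesis using b by (intro bexI[of _ b]) (auto simp: g_def)
  qed
  ultimately show ?thesis by (intro exI[of _ g]) blast
qed

section \<open>Contracting a compass structure\<close>

definition pending :: "'p labelling \<Rightarrow> nat \<Rightarrow> nat \<Rightarrow> 'p mpnl set" where
  "pending L x y = {\<psi> \<in> Req_r (L (x, x)). \<forall>y'. x \<le> y' \<longrightarrow> y' \<le> y \<longrightarrow> \<psi> \<notin> L (x, y')}"

lemma all_le_split:
  fixes a b c :: nat
  assumes "a \<le> b" "b \<le> c"
  shows "(\<forall>z. a \<le> z \<longrightarrow> z \<le> c \<longrightarrow> P z) \<longleftrightarrow>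
    (\<forall>z. a \<le> z \<longrightarrow> z \<le> b \<longrightarrow> P z) \<and> (\<forall>z. b \<le> z \<longrightarrow> z \<le> c \<longrightarrow> P z)"
  using assms by (meson le_cases order_trans)

lemma min_add_cong:
  fixes a b c k :: nat
  shows "min a k = min b k \<Longrightarrow> min (c + a) k = min (c + b) k"
  by (auto simp: min_def split: if_splits)

lemma marking_eq_pending:
  "y \<le> N \<Longrightarrow> marking \<phi> {0..N} L x y = (L (x, y), pending L x y, min (y - x) (k_max \<phi>))"
  by (auto simp: marking_def pending_def)

lemma points_iff [simp]: "(x, y) \<in> points {0..N} \<longleftrightarrow> x \<le> y \<and> y \<le> N"
  by (auto simp: points_def)

section \<open>Requests and types along a column\<close>

locale saturated_compass =
  fixes \<phi> :: "'p mpnl" and L :: "'p labelling" and N :: nat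
  assumes compass: "compass_structure \<phi> {0..N} L"
    and left: "\<And>x y. x \<le> y \<Longrightarrow> y \<le> N \<Longrightarrow> left_fulfilled {0..N} L x y"
begin

lemma label_in_atoms: "x \<le> y \<Longrightarrow> y \<le> N \<Longrightarrow> L (x, y) \<in> atoms \<phi>"
  using compass by (simp add: compass_structure_def)

lemma label_in_Cl: "x \<le> y \<Longrightarrow> y \<le> N \<Longrightarrow> \<alpha> \<in> L (x, y) \<Longrightarrow> \<alpha> \<in> Cl \<phi>"
  using label_in_atoms[of x y] by (auto simp: atoms_def)

lemma label_rel: "x \<le> y \<Longrightarrow> y \<le> z \<Longrightarrow> z \<le> N \<Longrightarrow> atom_rel \<phi> (L (x, y)) (L (y, z))"
  using compass by (simp add: compass_structure_def)

lemma label_Len: "x \<le> y \<Longrightarrow> y \<le> N \<Longrightarrow> Len k \<in> L (x, y) \<Longrightarrow> y - x < k"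
  using compass by (simp add: compass_structure_def)

lemma observed_r_requested:
  "x \<le> y \<Longrightarrow> y \<le> z \<Longrightarrow> z \<le> N \<Longrightarrow> \<psi> \<in> dia_r \<phi> \<Longrightarrow> \<psi> \<in> L (y, z) \<Longrightarrow> \<psi> \<in> Req_r (L (x, y))"
  using label_rel[of x y z] by (auto simp: atom_rel_def Obs_r_def dia_r_def)

lemma observed_l_requested:
  "x \<le> y \<Longrightarrow> y \<le> z \<Longrightarrow> z \<le> N \<Longrightarrow> \<psi> \<in> dia_l \<phi> \<Longrightarrow> \<psi> \<in> L (x, y) \<Longrightarrow> \<psi> \<in> Req_l (L (y, z))"
  using label_rel[of x y z] by (auto simp: atom_rel_def Obs_l_def dia_l_def)

lemma Req_r_subset_dia_r: "x \<le> y \<Longrightarrow> y \<le> N \<Longrightarrow> Req_r (L (x, y)) \<subseteq> dia_r \<phi>"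
  using label_in_Cl by (auto simp: Req_r_def dia_r_def)

lemma Req_l_subset_dia_l: "x \<le> y \<Longrightarrow> y \<le> N \<Longrightarrow> Req_l (L (x, y)) \<subseteq> dia_l \<phi>"
  using label_in_Cl by (auto simp: Req_l_def dia_l_def)

lemma left_witness:
  assumes "x \<le> y" "y \<le> N" "\<psi> \<in> Req_l (L (x, y))"
  obtains w where "w \<le> x" "\<psi> \<in> L (w, x)"
  using left[OF assms(1,2)] assms(3) by (auto simp: left_fulfilled_def)

text \<open>A left request at \<open>(x, y)\<close> concerns intervals ending in \<open>x\<close>:
  its witness in row \<open>x\<close> forces the request on every label of column \<open>x\<close>.
  Hence switching between columns with equal labels at \<open>y2\<close> never alters left
  requests.\<close>

lemma Req_l_column:
  assumes "x \<le> y" "y \<le> N" "x \<le> z" "z \<le> N"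
  shows "Req_l (L (x, y)) = Req_l (L (x, z))"
proof -
  have "Req_l (L (x, y)) \<subseteq> Req_l (L (x, z))"
    if le: "x \<le> y" "y \<le> N" "x \<le> z" "z \<le> N" for y z
  proof
    fix \<psi> assume \<psi>: "\<psi> \<in> Req_l (L (x, y))"
    then obtain w where "w \<le> x" "\<psi> \<in> L (w, x)"
      using left_witness[OF le(1,2)] by blast
    moreover have "\<psi> \<in> dia_l \<phi>" using \<psi> Req_l_subset_dia_l[OF le(1,2)] by blast
    ultimately show "\<psi> \<in> Req_l (L (x, z))"
      using observed_l_requested le(3,4) by blast
  qed
  then show ?thesis using assms by blast
qed

text \<open>Values of the status at row \<open>y\<close> of a formula in column \<open>x\<close>: 0 not requested, 1 fulfilled
  up to row \<open>y\<close>, 2 fulfilled only above row \<open>y\<close>, 3 never fulfilled.\<close>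

definition status :: "nat \<Rightarrow> nat \<Rightarrow> 'p mpnl \<Rightarrow> nat" where
  "status x y \<psi> =
     (if \<psi> \<notin> Req_r (L (x, x)) then 0
      else if \<psi> \<notin> pending L x y then 1
      else if \<psi> \<notin> pending L x N then 2 else 3)"

text \<open>The status splits pending formulae by their future, so equal types also predict what is
  pending in the top row. \<open>restrict\<close> makes the second component extensional, so that
  the types form a finite set.\<close>

definition ctype :: "nat \<Rightarrow> nat \<Rightarrow> 'p mpnl set \<times> ('p mpnl \<Rightarrow> nat) \<times> nat" where
  "ctype x y = (L (x, y), restrict (status x y) (dia_r \<phi>), min (y - x) (k_max \<phi>))"

lemma ctype_eqD:
  assumes "ctype x y = ctype x' y'"
  shows "L (x, y) = L (x', y')" "min (y - x) (k_max \<phi>) = min (y' - x') (k_max \<phi>)"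
    "\<psi> \<in> dia_r \<phi> \<Longrightarrow> status x y \<psi> = status x' y' \<psi>"
proof -
  have "restrict (status x y) (dia_r \<phi>) \<psi> = restrict (status x' y') (dia_r \<phi>) \<psi>"
    using assms by (simp add: ctype_def)
  then show "\<psi> \<in> dia_r \<phi> \<Longrightarrow> status x y \<psi> = status x' y' \<psi>" by simp
qed (use assms in \<open>auto simp: ctype_def\<close>)

lemma pending_antimono: "y \<le> z \<Longrightarrow> pending L x z \<subseteq> pending L x y"
  by (auto simp: pending_def)

lemma pending_subset_dia_r: "x \<le> N \<Longrightarrow> pending L x y \<subseteq> dia_r \<phi>"
  using Req_r_subset_dia_r[of x x] by (auto simp: pending_def)

lemma pending_iff_status:
  "y \<le> N \<Longrightarrow> \<psi> \<in> pending L x y \<longleftrightarrow> status x y \<psi> \<in> {2, 3}"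
  "y \<le> N \<Longrightarrow> \<psi> \<in> pending L x N \<longleftrightarrow> status x y \<psi> = 3"
  using pending_antimono[of y N x] by (auto simp: status_def pending_def)

end

section \<open>The contracted structure is again saturated\<close>

text \<open>\<open>G y x\<close> is the original column that column \<open>x\<close> follows in the
  original row \<open>y\<close>. Equal types make the switch at the cut sound,
  \<open>G_witness\<close> keeps left witnesses in each row above \<open>y2\<close>, and
  \<open>G_fulfil\<close> ensures that changing columns does not miss a request that was to be
  fulfilled later.\<close>

locale contraction = saturated_compass \<phi> L N
  for \<phi> :: "'p mpnl" and L :: "'p labelling" and N :: nat +
  fixes y1 y2 :: nat and G :: "nat \<Rightarrow> nat \<Rightarrow> nat"
  assumes y12: "y1 < y2" "y2 \<le> N"
    and G_le: "\<And>x y. x \<le> y1 \<Longrightarrow> G y x \<le> y2"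
    and G_ctype: "\<And>x y. x \<le> y1 \<Longrightarrow> ctype (G y x) y2 = ctype x y1"
    and G_witness: "\<And>w y \<psi>. y2 < y \<Longrightarrow> y \<le> N \<Longrightarrow> w \<le> y2 \<Longrightarrow> \<psi> \<in> dia_l \<phi> \<Longrightarrow> \<psi> \<in> L (w, y) \<Longrightarrow>
      \<exists>x\<le>y1. \<psi> \<in> L (G y x, y)"
    and G_fulfil: "\<And>x \<psi>. x \<le> y1 \<Longrightarrow> \<psi> \<in> dia_r \<phi> \<Longrightarrow> status x y1 \<psi> = 2 \<Longrightarrow>
      \<exists>y. y2 < y \<and> y \<le> N \<and> \<psi> \<in> L (G y x, y)"
begin

definition \<delta> :: nat where "\<delta> = y2 - y1"

text \<open>Row \<open>y\<close> of the contracted structure reads the original row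
  \<open>y + \<delta>\<close>, hence the argument of \<open>G\<close>; columns that start above the
  cut are merely shifted.\<close>

definition col :: "nat \<Rightarrow> nat \<Rightarrow> nat" where
  "col x y = (if x \<le> y1 then G (y + \<delta>) x else x + \<delta>)"

definition L' :: "'p labelling" where
  "L' p = (if snd p \<le> y1 then L p else L (col (fst p) (snd p), snd p + \<delta>))"

lemma \<delta>: "y1 + \<delta> = y2" "0 < \<delta>" "\<delta> \<le> N"
  using y12 by (auto simp: \<delta>_def)

lemma L'_low: "y \<le> y1 \<Longrightarrow> L' (x, y) = L (x, y)"
  by (simp add: L'_def)

lemma L'_high:
  assumes "x \<le> y" "y1 \<le> y"
  shows "L' (x, y) = L (col x y, y + \<delta>)"
proof (cases "y = y1")
  case True
  then show ?thesis
    using ctype_eqD(1)[OF G_ctype[of x y2]] assms \<delta> by (simp add: L'_low col_def)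
qed (use assms in \<open>simp add: L'_def\<close>)

lemma col_le: "x \<le> y \<Longrightarrow> y1 \<le> y \<Longrightarrow> col x y \<le> y + \<delta>"
  using G_le[of x "y + \<delta>"] \<delta> by (auto simp: col_def)

lemma L'_in_atoms:
  assumes "x \<le> y" "y \<le> N - \<delta>"
  shows "L' (x, y) \<in> atoms \<phi>"
proof (cases "y \<le> y1")
  case True
  then show ?thesis using label_in_atoms assms by (simp add: L'_low)
next
  case False
  then have "L' (x, y) = L (col x y, y + \<delta>)" "col x y \<le> y + \<delta>"
    using L'_high col_le assms by auto
  then show ?thesis using label_in_atoms[of "col x y" "y + \<delta>"] assms \<delta> by simp
qed

text \<open>Up to truncation the heights agree at the cut by equality of types, and above it both
  grow by \<open>y - y1\<close>; shifted columns keep their height.\<close>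

lemma min_height:
  assumes "x \<le> y" "y1 \<le> y"
  shows "min (y - x) (k_max \<phi>) = min (y + \<delta> - col x y) (k_max \<phi>)"
proof (cases "x \<le> y1")
  case True
  then have "min (y1 - x) (k_max \<phi>) = min (y2 - col x y) (k_max \<phi>)" "col x y \<le> y2"
    using ctype_eqD(2)[OF G_ctype[of x "y + \<delta>"]] G_le by (auto simp: col_def)
  moreover from this have "y - x = (y - y1) + (y1 - x)"
    "y + \<delta> - col x y = (y - y1) + (y2 - col x y)"
    using assms True \<delta> by auto
  ultimately show ?thesis using min_add_cong by metis
qed (auto simp: col_def)

lemma L'_Len:
  assumes "x \<le> y" "y \<le> N - \<delta>" "Len k \<in> L' (x, y)"
  shows "y - x < k"
proof (cases "y \<le> y1")
  case True
  then show ?thesis using label_Len assms by (simp add: L'_low)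
next
  case False
  then have L': "Len k \<in> L (col x y, y + \<delta>)" "col x y \<le> y + \<delta>"
    using L'_high[of x y] col_le assms by auto
  \<comment> \<open>Since \<open>k\<close> is at most \<open>k_max \<phi>\<close>, a height below
    \<open>k\<close> is not truncated, and equal truncated heights are then equal.\<close>
  then have "y + \<delta> - col x y < k" "k \<le> k_max \<phi>"
    using label_Len label_in_Cl[THEN Len_in_Cl_le_k_max] assms \<delta> by auto
  then show ?thesis using min_height[of x y] assms False by (auto simp: min_def split: if_splits)
qed

lemma Req_l_L':
  assumes "x \<le> y" "y1 \<le> y" "y \<le> N - \<delta>" "x \<le> y1"
  shows "Req_l (L' (x, y)) = Req_l (L (x, y1))"
proof -
  have G: "col x y \<le> y2" "L (col x y, y2) = L (x, y1)"
    using G_le ctype_eqD(1)[OF G_ctype[of x "y + \<delta>"]] assms by (auto simp: col_def)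
  have "Req_l (L' (x, y)) = Req_l (L (col x y, y + \<delta>))" using assms by (simp add: L'_high)
  also have "\<dots> = Req_l (L (col x y, y2))"
    using G assms \<delta> y12 by (intro Req_l_column) auto
  finally show ?thesis using G by simp
qed

lemma L'_rel:
  assumes "x \<le> y" "y \<le> z" "z \<le> N - \<delta>"
  shows "atom_rel \<phi> (L' (x, y)) (L' (y, z))"
proof -
  consider "z \<le> y1" | "y \<le> y1" "y1 < z" | "y1 < y" by linarith
  then show ?thesis
  proof cases
    case 1
    then show ?thesis using assms label_rel \<delta> by (simp add: L'_low)
  next
    case 2
    have z: "L' (y, z) = L (col y z, z + \<delta>)" "col y z \<le> z + \<delta>" "z + \<delta> \<le> N"
      using 2 assms L'_high[of y z] col_le \<delta> by auto
    have "Obs_r \<phi> (L' (y, z)) \<subseteq> Req_r (L (x, y))"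
    proof
      fix \<psi> assume "\<psi> \<in> Obs_r \<phi> (L' (y, z))"
      then have \<psi>: "\<psi> \<in> dia_r \<phi>" "\<psi> \<in> L (col y z, z + \<delta>)"
        using z by (auto simp: Obs_r_def dia_r_def)
      then have "\<psi> \<in> Req_r (L (col y z, col y z))"
        using z by (intro observed_r_requested[of _ _ "z + \<delta>"]) auto
      moreover have "\<psi> \<notin> pending L (col y z) N"
        using \<psi> z by (auto simp: pending_def)
      \<comment> \<open>Statuses 1 and 2 together say that the formula is fulfilled somewhere in the
        column. Equal types carry this over to column \<open>y\<close>, and an occurrence there
        forces the request at \<open>(x, y)\<close>.\<close>
      ultimately have "status (col y z) y2 \<psi> \<in> {1, 2}" by (simp add: status_def)
      then have "status y y1 \<psi> \<in> {1, 2}"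
        using ctype_eqD(3)[OF G_ctype[of y "z + \<delta>"]] \<psi>(1) 2 by (simp add: col_def)
      then have "\<psi> \<in> Req_r (L (y, y))" "\<psi> \<notin> pending L y N"
        using pending_antimono[of y1 N y] y12 by (auto simp: status_def split: if_splits)
      then obtain y' where "y \<le> y'" "y' \<le> N" "\<psi> \<in> L (y, y')"
        by (auto simp: pending_def)
      then show "\<psi> \<in> Req_r (L (x, y))"
        using observed_r_requested \<psi>(1) assms(1) by blast
    qed
    moreover have "Obs_l \<phi> (L (x, y)) \<subseteq> Req_l (L' (y, z))"
    proof
      fix \<psi> assume "\<psi> \<in> Obs_l \<phi> (L (x, y))"
      then have "\<psi> \<in> Req_l (L (y, y1))"
        using observed_l_requested[of x y y1] assms 2 y12 by (auto simp: Obs_l_def dia_l_def)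
      then show "\<psi> \<in> Req_l (L' (y, z))" using Req_l_L' assms 2 by simp
    qed
    ultimately show ?thesis using 2 by (simp add: atom_rel_def L'_low)
  next
    case 3
    then have "L' (x, y) = L (col x y, y + \<delta>)" "L' (y, z) = L (y + \<delta>, z + \<delta>)"
      "col x y \<le> y + \<delta>"
      using assms L'_high[of x y] L'_high[of y z] col_le by (auto simp: col_def)
    then show ?thesis using label_rel[of "col x y" "y + \<delta>" "z + \<delta>"] assms \<delta> by simp
  qed
qed

text \<open>For \<open>x \<le> y1\<close> the witness lies in an untouched row. Above the cut,
  witnesses of the original row \<open>x + \<delta>\<close> in columns up to \<open>y2\<close> come
  back through \<open>G_witness\<close>, and the others are shifted.\<close>

lemma L'_left_fulfilled:
  assumes "x \<le> y" "y \<le> N - \<delta>"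
  shows "left_fulfilled {0..N - \<delta>} L' x y"
  unfolding left_fulfilled_def
proof
  fix \<psi> assume \<psi>: "\<psi> \<in> Req_l (L' (x, y))"
  show "\<exists>w. (w, x) \<in> points {0..N - \<delta>} \<and> \<psi> \<in> L' (w, x)"
  proof (cases "x \<le> y1")
    case True
    obtain z where "x \<le> z" "z \<le> N" "\<psi> \<in> Req_l (L (x, z))"
    proof (cases "y \<le> y1")
      case True
      then show ?thesis using that[of y] \<psi> assms by (simp add: L'_low)
    next
      case False
      then show ?thesis using that[of y1] \<psi> assms True y12 Req_l_L'[of x y] by simp
    qed
    then obtain w where "w \<le> x" "\<psi> \<in> L (w, x)" by (rule left_witness)
    then show ?thesis using True assms by (intro exI[of _ w]) (simp add: L'_low)
  next
    case False
    then have \<psi>': "\<psi> \<in> Req_l (L (x + \<delta>, y + \<delta>))"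
      using \<psi> assms L'_high[of x y] by (simp add: col_def)
    have le: "x + \<delta> \<le> y + \<delta>" "y + \<delta> \<le> N" using assms \<delta> by auto
    then obtain w where w: "w \<le> x + \<delta>" "\<psi> \<in> L (w, x + \<delta>)"
      using left_witness[OF _ _ \<psi>'] by blast
    have L'x: "L' (v, x) = L (col v x, x + \<delta>)" if "v \<le> x" for v
      using that False by (intro L'_high) auto
    show ?thesis
    proof (cases "w \<le> y2")
      case True
      have "\<psi> \<in> dia_l \<phi>" using Req_l_subset_dia_l[OF le] \<psi>' by blast
      then obtain v where "v \<le> y1" "\<psi> \<in> L (G (x + \<delta>) v, x + \<delta>)"
        using G_witness[of "x + \<delta>" w \<psi>] True w False le \<delta> by auto
      then show ?thesis
        using False assms L'x[of v] by (intro exI[of _ v]) (auto simp: col_def)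
    next
      case w2: False
      then have "\<psi> \<in> L' (w - \<delta>, x)"
        using L'x[of "w - \<delta>"] w \<delta> by (auto simp: col_def)
      then show ?thesis
        using w assms by (intro exI[of _ "w - \<delta>"]) auto
    qed
  qed
qed

lemma saturated_L': "saturated_compass \<phi> L' (N - \<delta>)"
proof
  show "compass_structure \<phi> {0..N - \<delta>} L'"
    unfolding compass_structure_def
    using L'_in_atoms L'_rel L'_Len by (auto simp: points_def)
qed (rule L'_left_fulfilled)

section \<open>Pending requests and markings after contraction\<close>

lemma pending_L'_low: "x \<le> y \<Longrightarrow> y \<le> y1 \<Longrightarrow> pending L' x y = pending L x y"
  by (auto simp: pending_def L'_low)

lemma pending_L'_right:
  assumes "y1 < x" "x \<le> y"
  shows "pending L' x y = pending L (x + \<delta>) (y + \<delta>)"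
proof -
  have L': "L' (x, z) = L (x + \<delta>, z + \<delta>)" if "x \<le> z" for z
    using that assms L'_high[of x z] by (simp add: col_def)
  have "(\<forall>z. x \<le> z \<longrightarrow> z \<le> y \<longrightarrow> \<psi> \<notin> L' (x, z)) \<longleftrightarrow>
    (\<forall>z. x + \<delta> \<le> z \<longrightarrow> z \<le> y + \<delta> \<longrightarrow> \<psi> \<notin> L (x + \<delta>, z))" for \<psi>
  proof safe
    fix z assume *: "\<forall>z. x \<le> z \<longrightarrow> z \<le> y \<longrightarrow> \<psi> \<notin> L' (x, z)"
      "x + \<delta> \<le> z" "z \<le> y + \<delta>" "\<psi> \<in> L (x + \<delta>, z)"
    then have "x \<le> z - \<delta>" "z - \<delta> \<le> y" "z - \<delta> + \<delta> = z" by auto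
    with * L'[of "z - \<delta>"] show False by auto
  next
    fix z assume *: "\<forall>z. x + \<delta> \<le> z \<longrightarrow> z \<le> y + \<delta> \<longrightarrow> \<psi> \<notin> L (x + \<delta>, z)"
      "x \<le> z" "z \<le> y" "\<psi> \<in> L' (x, z)"
    with L'[of z] show False by auto
  qed
  then show ?thesis using L'[of x] by (auto simp: pending_def)
qed

text \<open>A column that follows one \<open>w\<close> throughout inherits its whole history above
  \<open>y2\<close>, while the types match what is pending at the cut. Representatives of top
  markings need this exactness in a row below the top.\<close>

lemma pending_L'_fixed:
  assumes x: "x \<le> y1" "y1 \<le> y" "y \<le> N - \<delta>" and w: "\<And>y. G y x = w"
  shows "pending L' x y = pending L w (y + \<delta>)"
proof -
  have L': "L' (x, z) = L (w, z + \<delta>)" if "y1 \<le> z" for z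
    using that x L'_high[of x z] w by (simp add: col_def)
  have wy: "w \<le> y2" "w \<le> N" "x \<le> N" using G_le[of x y] w x y12 by auto
  have split': "\<psi> \<in> pending L' x y \<longleftrightarrow>
      \<psi> \<in> pending L x y1 \<and> (\<forall>z. y1 \<le> z \<longrightarrow> z \<le> y \<longrightarrow> \<psi> \<notin> L' (x, z))" for \<psi>
    unfolding pending_def all_le_split[OF x(1,2)] using x(1) by (auto simp: L'_low)
  have "y2 \<le> y + \<delta>" using x \<delta> by simp
  then have split: "\<psi> \<in> pending L w (y + \<delta>) \<longleftrightarrow>
      \<psi> \<in> pending L w y2 \<and> (\<forall>z. y2 \<le> z \<longrightarrow> z \<le> y + \<delta> \<longrightarrow> \<psi> \<notin> L (w, z))" for \<psi>
    unfolding pending_def all_le_split[OF wy(1) \<open>y2 \<le> y + \<delta>\<close>] by blast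
  have "\<psi> \<in> pending L x y1 \<longleftrightarrow> \<psi> \<in> pending L w y2" for \<psi>
  proof (cases "\<psi> \<in> dia_r \<phi>")
    case True
    then show ?thesis
      using ctype_eqD(3)[OF G_ctype[of x y]] w x y12 by (simp add: pending_iff_status)
  next
    case False
    then show ?thesis using pending_subset_dia_r wy by blast
  qed
  moreover have "(\<forall>z. y1 \<le> z \<longrightarrow> z \<le> y \<longrightarrow> \<psi> \<notin> L' (x, z)) \<longleftrightarrow>
    (\<forall>z. y2 \<le> z \<longrightarrow> z \<le> y + \<delta> \<longrightarrow> \<psi> \<notin> L (w, z))" for \<psi>
  proof safe
    fix z assume *: "\<forall>z. y1 \<le> z \<longrightarrow> z \<le> y \<longrightarrow> \<psi> \<notin> L' (x, z)"
      "y2 \<le> z" "z \<le> y + \<delta>" "\<psi> \<in> L (w, z)"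
    then have "y1 \<le> z - \<delta>" "z - \<delta> \<le> y" "z - \<delta> + \<delta> = z" using \<delta> by auto
    with * L'[of "z - \<delta>"] show False by auto
  next
    fix z assume *: "\<forall>z. y2 \<le> z \<longrightarrow> z \<le> y + \<delta> \<longrightarrow> \<psi> \<notin> L (w, z)"
      "y1 \<le> z" "z \<le> y" "\<psi> \<in> L' (x, z)"
    with L'[of z] \<delta> show False by auto
  qed
  ultimately show ?thesis using split split' by blast
qed

text \<open>Rerouting may fulfil requests earlier, but at the top row exactly those with status 3
  remain, since all columns visited agree on them.\<close>

lemma pending_L'_top:
  assumes x: "x \<le> y1"
  shows "pending L' x (N - \<delta>) = pending L x N"
proof -
  have Req: "Req_r (L' (x, x)) = Req_r (L (x, x))" using x by (simp add: L'_low)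
  have "(\<exists>z. x \<le> z \<and> z \<le> N - \<delta> \<and> \<psi> \<in> L' (x, z)) \<longleftrightarrow> \<psi> \<notin> pending L x N"
    if \<psi>: "\<psi> \<in> Req_r (L (x, x))" for \<psi>
  proof
    have dia: "\<psi> \<in> dia_r \<phi>" using \<psi> Req_r_subset_dia_r[of x x] x y12 by auto
    {
      assume "\<exists>z. x \<le> z \<and> z \<le> N - \<delta> \<and> \<psi> \<in> L' (x, z)"
      then obtain z where z: "x \<le> z" "z \<le> N - \<delta>" "\<psi> \<in> L' (x, z)" by blast
      show "\<psi> \<notin> pending L x N"
      proof (cases "z \<le> y1")
        case True
        then show ?thesis using z y12 by (auto simp: pending_def L'_low)
      next
        case False
        then have "\<psi> \<in> L (G (z + \<delta>) x, z + \<delta>)"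
          using z x L'_high[of x z] by (simp add: col_def)
        moreover have "G (z + \<delta>) x \<le> y2" "y2 \<le> z + \<delta>" "z + \<delta> \<le> N"
          using G_le[OF x] z False \<delta> by auto
        ultimately have "\<psi> \<notin> pending L (G (z + \<delta>) x) N"
          unfolding pending_def using order_trans by blast
        then have "status (G (z + \<delta>) x) y2 \<psi> \<noteq> 3" using pending_iff_status(2) y12 by simp
        then have "status x y1 \<psi> \<noteq> 3" using ctype_eqD(3)[OF G_ctype[OF x] dia] by simp
        then show ?thesis using pending_iff_status(2)[of y1] y12 by simp
      qed
    next
      assume "\<psi> \<notin> pending L x N"
      then consider "\<psi> \<notin> pending L x y1" | "status x y1 \<psi> = 2"
        using \<psi> by (cases "\<psi> \<in> pending L x y1") (simp_all add: status_def)
      then show "\<exists>z. x \<le> z \<and> z \<le> N - \<delta> \<and> \<psi> \<in> L' (x, z)"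
      proof cases
        case 1
        then obtain z where "x \<le> z" "z \<le> y1" "\<psi> \<in> L (x, z)"
          using \<psi> by (auto simp: pending_def)
        then show ?thesis using \<delta> y12 by (intro exI[of _ z]) (auto simp: L'_low)
      next
        case 2
        then obtain y where y: "y2 < y" "y \<le> N" "\<psi> \<in> L (G y x, y)"
          using G_fulfil[OF x dia] by blast
        then have "y - \<delta> + \<delta> = y" "y1 \<le> y - \<delta>" "x \<le> y - \<delta>" "y - \<delta> \<le> N - \<delta>"
          using \<delta> x by auto
        moreover from this have "\<psi> \<in> L' (x, y - \<delta>)"
          using y(3) x L'_high[of x "y - \<delta>"] by (simp add: col_def)
        ultimately show ?thesis by blast
      qed
    }
  qed
  then show ?thesis using Req by (auto simp: pending_def)
qed

lemma marking_L'_top: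
  assumes x: "x \<le> N - \<delta>"
  shows "marking \<phi> {0..N - \<delta>} L' x (N - \<delta>) = marking \<phi> {0..N} L (col x (N - \<delta>)) N"
proof -
  have N: "y1 \<le> N - \<delta>" "N - \<delta> + \<delta> = N" using \<delta> y12 by auto
  have "pending L' x (N - \<delta>) = pending L (col x (N - \<delta>)) N"
  proof (cases "x \<le> y1")
    case True
    have "\<psi> \<in> pending L x N \<longleftrightarrow> \<psi> \<in> pending L (G N x) N" for \<psi>
    proof (cases "\<psi> \<in> dia_r \<phi>")
      case dia: True
      then show ?thesis
        using ctype_eqD(3)[OF G_ctype[OF True, of N] dia] pending_iff_status(2) y12
        by (metis less_imp_le order_trans)
    next
      case False
      moreover have "x \<le> N" "G N x \<le> N" using G_le[OF True, of N] True y12 by auto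
      ultimately show ?thesis using pending_subset_dia_r by blast
    qed
    then show ?thesis using True pending_L'_top N by (auto simp: col_def)
  next
    case False
    then show ?thesis using pending_L'_right[of x "N - \<delta>"] x N by (simp add: col_def)
  qed
  then show ?thesis
    using L'_high[OF x N(1)] min_height[OF x N(1)] N by (simp add: marking_eq_pending)
qed

lemma marking_L'_low:
  assumes "x \<le> y" "y \<le> y1"
  shows "marking \<phi> {0..N - \<delta>} L' x y = marking \<phi> {0..N} L x y"
  using assms \<delta> y12 by (simp add: marking_eq_pending pending_L'_low L'_low)

lemma marking_L'_right:
  assumes "y1 < x" "x \<le> y" "y \<le> N - \<delta>"
  shows "marking \<phi> {0..N - \<delta>} L' x y = marking \<phi> {0..N} L (x + \<delta>) (y + \<delta>)"
  using assms \<delta> y12 L'_high[of x y] by (simp add: marking_eq_pending pending_L'_right col_def)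

lemma marking_L'_fixed:
  assumes "x \<le> y1" "y1 \<le> y" "y \<le> N - \<delta>" and w: "\<And>y. G y x = w"
  shows "marking \<phi> {0..N - \<delta>} L' x y = marking \<phi> {0..N} L w (y + \<delta>)"
  using assms \<delta> y12 L'_high[of x y] min_height[of x y] pending_L'_fixed[OF assms]
  by (simp add: marking_eq_pending col_def)

end

section \<open>Existence of contractions and the number of rows\<close>

context saturated_compass
begin

definition cls :: "nat \<Rightarrow> 'p mpnl set \<times> ('p mpnl \<Rightarrow> nat) \<times> nat \<Rightarrow> nat set" where
  "cls y \<tau> = {x. x \<le> y \<and> ctype x y = \<tau>}"

lemma finite_cls [simp]: "finite (cls y \<tau>)"
  by (simp add: cls_def)

text \<open>Rerouting is done separately in each class of equal type, and the pieces are glued along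
  \<open>ctype x y1\<close>. The set \<open>W\<close> holds the columns that are to be followed
  permanently.\<close>

lemma ex_contraction:
  assumes y12: "y1 < y2" "y2 \<le> N" and W: "W \<subseteq> {..y2}"
    and c: "card W + card (dia_l \<phi>) * (card (dia_r \<phi>) + 1) < c"
    and eq: "\<And>\<tau>. min c (card (cls y1 \<tau>)) = min c (card (cls y2 \<tau>))"
  obtains G where "contraction \<phi> L N y1 y2 G" "\<And>w. w \<in> W \<Longrightarrow> \<exists>x\<le>y1. \<forall>y. G y x = w"
proof -
  \<comment> \<open>One witness per row and formula is fixed before splitting into classes; each
    class then has to cover at most \<open>card (dia_l \<phi>)\<close> of them in a row.\<close>
  define wit where "wit y \<psi> = (SOME w. w \<le> y2 \<and> \<psi> \<in> L (w, y))" for y \<psi>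
  have wit: "wit y \<psi> \<le> y2 \<and> \<psi> \<in> L (wit y \<psi>, y)" if "w \<le> y2" "\<psi> \<in> L (w, y)" for w y \<psi>
    unfolding wit_def by (rule someI[of _ w]) (use that in simp)
  define V where "V y = wit y ` {\<psi> \<in> dia_l \<phi>. \<exists>w\<le>y2. \<psi> \<in> L (w, y)}" for y
  have finV: "finite (V y)" for y by (simp add: V_def)
  have cardV: "card (V y) \<le> card (dia_l \<phi>)" for y
    unfolding V_def by (rule order_trans[OF card_image_le card_mono]) auto
  \<comment> \<open>For a formula fulfilled only above \<open>y2\<close>, one row that does so is
    fixed; \<open>Z b\<close> collects these rows, in which a column relying on \<open>b\<close>
    must really follow \<open>b\<close>.\<close>
  define row where "row b \<psi> = (SOME y. y2 < y \<and> y \<le> N \<and> \<psi> \<in> L (b, y))" for b \<psi>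
  have row: "y2 < row b \<psi> \<and> row b \<psi> \<le> N \<and> \<psi> \<in> L (b, row b \<psi>)" if "status b y2 \<psi> = 2" for b \<psi>
  proof -
    have "\<psi> \<in> pending L b y2" "\<psi> \<notin> pending L b N"
      using that by (auto simp: status_def split: if_splits)
    then obtain y where "b \<le> y" "y \<le> N" "\<psi> \<in> L (b, y)"
      by (auto simp: pending_def)
    moreover from this have "\<not> y \<le> y2"
      using \<open>\<psi> \<in> pending L b y2\<close> by (auto simp: pending_def)
    ultimately have "\<exists>y. y2 < y \<and> y \<le> N \<and> \<psi> \<in> L (b, y)"
      using not_le by blast
    then show ?thesis unfolding row_def by (rule someI_ex)
  qed
  define Z where "Z b = row b ` {\<psi> \<in> dia_r \<phi>. status b y2 \<psi> = 2}" for b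
  have finZ: "finite (Z b)" for b by (simp add: Z_def)
  have cardZ: "card (Z b) \<le> card (dia_r \<phi>)" for b
    unfolding Z_def by (rule order_trans[OF card_image_le card_mono]) auto
  have "\<exists>g. (\<forall>y. \<forall>x\<in>cls y1 \<tau>. g y x \<in> cls y2 \<tau>)
    \<and> (\<forall>w\<in>W \<inter> cls y2 \<tau>. \<exists>x\<in>cls y1 \<tau>. \<forall>y. g y x = w)
    \<and> (\<forall>y. V y \<inter> cls y2 \<tau> \<subseteq> g y ` cls y1 \<tau>)
    \<and> (\<forall>x\<in>cls y1 \<tau>. \<exists>b\<in>cls y2 \<tau>. \<forall>y\<in>Z b. g y x = b)" for \<tau>
  proof (rule ex_rerouting)
    have "finite W" using W finite_subset by blast
    then have "card (W \<inter> cls y2 \<tau>) \<le> card W" by (intro card_mono) auto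
    then show "card (W \<inter> cls y2 \<tau>) + card (dia_l \<phi>) * (card (dia_r \<phi>) + 1) < c"
      using c by linarith
    show "card (V y \<inter> cls y2 \<tau>) \<le> card (dia_l \<phi>)" for y
      using card_mono[OF finV, of "V y \<inter> cls y2 \<tau>" y] cardV[of y] by auto
  qed (use finZ cardZ eq in auto)
  then obtain g where g: "\<And>\<tau> y x. x \<in> cls y1 \<tau> \<Longrightarrow> g \<tau> y x \<in> cls y2 \<tau>"
    "\<And>\<tau> w. w \<in> W \<inter> cls y2 \<tau> \<Longrightarrow> \<exists>x\<in>cls y1 \<tau>. \<forall>y. g \<tau> y x = w"
    "\<And>\<tau> y. V y \<inter> cls y2 \<tau> \<subseteq> g \<tau> y ` cls y1 \<tau>"
    "\<And>\<tau> x. x \<in> cls y1 \<tau> \<Longrightarrow> \<exists>b\<in>cls y2 \<tau>. \<forall>y\<in>Z b. g \<tau> y x = b"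
    by metis
  define G where "G y x = g (ctype x y1) y x" for y x
  have own: "x \<in> cls y1 (ctype x y1)" if "x \<le> y1" for x using that by (simp add: cls_def)
  have G: "G y x \<in> cls y2 (ctype x y1)" if "x \<le> y1" for x y
    unfolding G_def using g(1) own that by blast
  have "contraction \<phi> L N y1 y2 G"
  proof
    show "G y x \<le> y2" "ctype (G y x) y2 = ctype x y1" if "x \<le> y1" for x y
      using G[OF that, of y] by (auto simp: cls_def)
    show "\<exists>x\<le>y1. \<psi> \<in> L (G y x, y)"
      if "y2 < y" "y \<le> N" "w \<le> y2" "\<psi> \<in> dia_l \<phi>" "\<psi> \<in> L (w, y)" for w y \<psi>
    proof -
      let ?w = "wit y \<psi>"
      have w: "?w \<le> y2" "\<psi> \<in> L (?w, y)" using wit[OF that(3,5)] by auto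
      have "?w \<in> V y \<inter> cls y2 (ctype ?w y2)"
        using that w(1) by (auto simp: V_def cls_def)
      then obtain x where x: "x \<in> cls y1 (ctype ?w y2)" "g (ctype ?w y2) y x = ?w"
        using g(3)[of y "ctype ?w y2"] by (auto simp: image_iff)
      then have "x \<le> y1" "G y x = ?w" by (auto simp: cls_def G_def)
      then show ?thesis using w by auto
    qed
    show "\<exists>y. y2 < y \<and> y \<le> N \<and> \<psi> \<in> L (G y x, y)"
      if x: "x \<le> y1" "\<psi> \<in> dia_r \<phi>" "status x y1 \<psi> = 2" for x \<psi>
    proof -
      obtain b where b: "b \<in> cls y2 (ctype x y1)" "\<forall>y\<in>Z b. G y x = b"
        using g(4)[OF own[OF x(1)]] by (auto simp: G_def)
      \<comment> \<open>The column \<open>b\<close> shares the type of \<open>x\<close> and hence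
        the status, so the chosen row lies in \<open>Z b\<close> and \<open>G\<close> follows
        \<open>b\<close> there.\<close>
      then have "status b y2 \<psi> = 2"
        using ctype_eqD(3)[of b y2 x y1 \<psi>] x by (simp add: cls_def)
      then show ?thesis
        using row[of b \<psi>] b(2) x(2) by (intro exI[of _ "row b \<psi>"]) (auto simp: Z_def)
    qed
  qed (use y12 in auto)
  moreover have "\<exists>x\<le>y1. \<forall>y. G y x = w" if "w \<in> W" for w
  proof -
    have "w \<in> W \<inter> cls y2 (ctype w y2)" using that W by (auto simp: cls_def)
    then obtain x where "x \<in> cls y1 (ctype w y2)" "\<forall>y. g (ctype w y2) y x = w"
      using g(2) by blast
    then show ?thesis by (auto simp: cls_def G_def)
  qed
  ultimately show ?thesis using that by blast
qed

text \<open>Rows are sent to their capped type counts, which are functions from \<open>T\<close> to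
  \<open>{..c}\<close>; distinctness makes this injective, with \<open>c + 1\<close> values per
  type.\<close>

lemma card_rows_le:
  assumes T: "finite T" "\<And>x y. y \<in> R \<Longrightarrow> x \<le> y \<Longrightarrow> ctype x y \<in> T"
    and distinct: "\<And>y1 y2. y1 \<in> R \<Longrightarrow> y2 \<in> R \<Longrightarrow> y1 < y2 \<Longrightarrow>
      \<exists>\<tau>. min c (card (cls y1 \<tau>)) \<noteq> min c (card (cls y2 \<tau>))"
  shows "card R \<le> (c + 1) ^ card T"
proof -
  let ?f = "\<lambda>y. \<lambda>\<tau>\<in>T. min c (card (cls y \<tau>))"
  have neq: "?f y1 \<noteq> ?f y2" if y: "y1 \<in> R" "y2 \<in> R" "y1 < y2" for y1 y2
  proof
    assume f: "?f y1 = ?f y2"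
    obtain \<tau> where \<tau>: "min c (card (cls y1 \<tau>)) \<noteq> min c (card (cls y2 \<tau>))"
      using distinct[OF y] by blast
    show False
    proof (cases "\<tau> \<in> T")
      case True
      then show False using fun_cong[OF f, of \<tau>] \<tau> by simp
    next
      case False
      then have "cls y1 \<tau> = {}" "cls y2 \<tau> = {}" using T(2) y by (auto simp: cls_def)
      then show False using \<tau> by simp
    qed
  qed
  have "inj_on ?f R"
    by (rule inj_onI) (metis neq linorder_neqE_nat)
  moreover have "?f ` R \<subseteq> T \<rightarrow>\<^sub>E {..c}" by auto
  ultimately have "card R \<le> card (T \<rightarrow>\<^sub>E {..c})"
    using T(1) by (intro card_inj_on_le) (auto intro: finite_PiE)
  also have "\<dots> = (c + 1) ^ card T" using T(1) by (simp add: card_PiE)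
  finally show ?thesis .
qed

end

section \<open>Generators\<close>

text \<open>\<open>y\<close> plays the part of \<open>y_inf\<close>, made explicit because it moves
  under some contractions. Configurations are replaced by representatives: each top column has a
  column of equal marking in row \<open>y\<close>.\<close>

definition generator_at :: "'p mpnl \<Rightarrow> 'p labelling \<Rightarrow> nat \<Rightarrow> nat \<Rightarrow> bool" where
  "generator_at \<phi> L N y \<longleftrightarrow> saturated_compass \<phi> L N \<and> features {0..N} L \<phi> \<and>
     y + k_max \<phi> \<le> N \<and>
     (\<forall>x\<le>N. \<exists>x'\<le>y. marking \<phi> {0..N} L x' y = marking \<phi> {0..N} L x N) \<and>
     (\<forall>x\<le>y. pending L x N = {})"

lemma dia_r_subset_Cl: "dia_r \<phi> \<subseteq> Cl \<phi>"
proof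
  fix \<psi> assume "\<psi> \<in> dia_r \<phi>"
  then obtain \<alpha> where \<alpha>: "DiaR \<alpha> \<in> subfms \<phi>" "\<psi> = nf \<alpha>" using dia_r_subset by blast
  have "\<alpha> \<in> subfms (DiaR \<alpha>)" by (cases \<alpha>) auto
  then have "\<alpha> \<in> subfms \<phi>" using subfms_trans \<alpha>(1) by blast
  then show "\<psi> \<in> Cl \<phi>" using \<alpha>(2) by (simp add: Cl_def)
qed

lemma config_pos_iff: "config \<phi> {0..N} L y m > 0 \<longleftrightarrow> (\<exists>x\<le>y. y \<le> N \<and> marking \<phi> {0..N} L x y = m)"
  by (auto simp: config_def card_gt_0_iff)

lemma N_compass_generator_iff:
  "N_compass_generator \<phi> D L \<longleftrightarrow> (\<exists>N y. D = {0..N} \<and> generator_at \<phi> L N y)"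
proof
  assume "N_compass_generator \<phi> D L"
  then obtain N y where N: "D = {0..N}" "compass_structure \<phi> {0..N} L" "features {0..N} L \<phi>"
    "\<And>x y. x \<le> y \<Longrightarrow> y \<le> N \<Longrightarrow> left_fulfilled {0..N} L x y" "y \<le> N" "N - y \<ge> k_max \<phi>"
    "\<And>m. m \<in> marked_atoms \<phi> \<Longrightarrow> config \<phi> {0..N} L N m > 0 \<Longrightarrow> config \<phi> {0..N} L y m > 0"
    "\<And>x. x \<le> y \<Longrightarrow> \<exists>F h. marking \<phi> {0..N} L x N = (F, {}, h)"
    unfolding N_compass_generator_def by fastforce
  interpret saturated_compass \<phi> L N using N by unfold_locales auto
  have "\<exists>x'\<le>y. marking \<phi> {0..N} L x' y = marking \<phi> {0..N} L x N" if "x \<le> N" for x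
  proof -
    have "marking \<phi> {0..N} L x N \<in> marked_atoms \<phi>"
      using that label_in_atoms pending_subset_dia_r[of x N] dia_r_subset_Cl[of \<phi>]
      by (auto simp: marked_atoms_def marking_eq_pending)
    moreover have "config \<phi> {0..N} L N (marking \<phi> {0..N} L x N) > 0"
      using that by (auto simp: config_pos_iff)
    ultimately have "config \<phi> {0..N} L y (marking \<phi> {0..N} L x N) > 0" by (rule N(7))
    then show ?thesis by (auto simp: config_pos_iff)
  qed
  moreover have "pending L x N = {}" if "x \<le> y" for x
    using N(8)[OF that] by (auto simp: marking_eq_pending)
  ultimately have "generator_at \<phi> L N y"
    using N saturated_compass_axioms by (auto simp: generator_at_def)
  then show "\<exists>N y. D = {0..N} \<and> generator_at \<phi> L N y" using N(1) by blast
next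
  assume "\<exists>N y. D = {0..N} \<and> generator_at \<phi> L N y"
  then obtain N y where N: "D = {0..N}" "generator_at \<phi> L N y" by blast
  then interpret saturated_compass \<phi> L N by (simp add: generator_at_def)
  have rep: "\<exists>x'\<le>y. marking \<phi> {0..N} L x' y = marking \<phi> {0..N} L x N" if "x \<le> N" for x
    using N(2) that by (simp add: generator_at_def)
  have "features {0..N} L \<phi>" "y \<le> N" "N - y \<ge> k_max \<phi>" "\<And>x. x \<le> y \<Longrightarrow> pending L x N = {}"
    using N(2) by (auto simp: generator_at_def)
  moreover have "config \<phi> {0..N} L y m > 0" if m: "config \<phi> {0..N} L N m > 0" for m
  proof -
    obtain x where "x \<le> N" "marking \<phi> {0..N} L x N = m" using m config_pos_iff by blast
    then show ?thesis using rep \<open>y \<le> N\<close> by (auto simp: config_pos_iff)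
  qed
  ultimately show "N_compass_generator \<phi> D L"
    unfolding N_compass_generator_def N(1)
    by (intro exI[of _ N] conjI bexI[of _ y])
      (use compass left in \<open>auto simp: marking_eq_pending\<close>)
qed

section \<open>Generators that survive a contraction\<close>

context contraction
begin

text \<open>The original rows \<open>y1 + 1\<close> to \<open>y2\<close> are lost, so
  \<open>y0\<close> must avoid them; a column \<open>x0 \<le> y2\<close> is kept by being followed
  permanently, a later one by the shift.\<close>

lemma features_L':
  assumes f: "x0 \<le> y0" "y0 \<le> N" "nf \<phi> \<in> L (x0, y0)"
    and y0: "y0 \<le> y1 \<or> y2 < y0"
    and x0: "x0 \<le> y2 \<Longrightarrow> \<exists>x\<le>y1. \<forall>y. G y x = x0"
  shows "features {0..N - \<delta>} L' \<phi>"
proof -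
  consider "y0 \<le> y1" | "y2 < y0" "y2 < x0" | x where "y2 < y0" "x \<le> y1" "\<forall>y. G y x = x0"
    using y0 x0 by fastforce
  then have "\<exists>x y. x \<le> y \<and> y \<le> N - \<delta> \<and> nf \<phi> \<in> L' (x, y)"
  proof cases
    case 1
    then show ?thesis using f \<delta> y12 by (intro exI[of _ x0] exI[of _ y0]) (auto simp: L'_low)
  next
    case 2
    then have "col (x0 - \<delta>) (y0 - \<delta>) = x0" "y0 - \<delta> + \<delta> = y0" "x0 - \<delta> \<le> y0 - \<delta>" "y1 \<le> y0 - \<delta>"
      using \<delta> f by (auto simp: col_def)
    then show ?thesis
      using f L'_high[of "x0 - \<delta>" "y0 - \<delta>"] by (intro exI[of _ "x0 - \<delta>"] exI[of _ "y0 - \<delta>"]) auto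
  next
    case 3
    then have "col x (y0 - \<delta>) = x0" "y0 - \<delta> + \<delta> = y0" "x \<le> y0 - \<delta>" "y1 \<le> y0 - \<delta>"
      using \<delta> f by (auto simp: col_def)
    then show ?thesis
      using f L'_high[of x "y0 - \<delta>"] by (intro exI[of _ x] exI[of _ "y0 - \<delta>"]) auto
  qed
  then show ?thesis by (force simp: features_def)
qed

text \<open>The cut lies below \<open>y\<close>, which moves down by \<open>\<delta>\<close>
  together with the representatives in its row. Those in columns up to \<open>y2\<close> survive
  because some column follows them permanently, the others by the shift; every new top marking is an
  old one.\<close>

lemma generator_at_L'_stem:
  assumes gen: "generator_at \<phi> L N y" and y: "y2 < y"
    and feat: "features {0..N - \<delta>} L' \<phi>"
    and rep: "\<And>x. x \<le> N \<Longrightarrow> \<exists>x'\<le>y. marking \<phi> {0..N} L x' y = marking \<phi> {0..N} L x N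
      \<and> (x' \<le> y2 \<longrightarrow> (\<exists>v\<le>y1. \<forall>z. G z v = x'))"
  shows "generator_at \<phi> L' (N - \<delta>) (y - \<delta>)"
proof -
  have yN: "y + k_max \<phi> \<le> N" and pend: "\<And>x. x \<le> y \<Longrightarrow> pending L x N = {}"
    using gen by (auto simp: generator_at_def)
  have y\<delta>: "y - \<delta> + \<delta> = y" "y1 < y - \<delta>" using y \<delta> by auto
  have "\<exists>x'\<le>y - \<delta>. marking \<phi> {0..N - \<delta>} L' x' (y - \<delta>) = marking \<phi> {0..N - \<delta>} L' x (N - \<delta>)"
    if x: "x \<le> N - \<delta>" for x
  proof -
    have "col x (N - \<delta>) \<le> N" using col_le[of x "N - \<delta>"] x \<delta> y12 by auto
    then obtain x' where x': "x' \<le> y"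
      "marking \<phi> {0..N} L x' y = marking \<phi> {0..N - \<delta>} L' x (N - \<delta>)"
      "x' \<le> y2 \<longrightarrow> (\<exists>v\<le>y1. \<forall>z. G z v = x')"
      using rep marking_L'_top[OF x] by metis
    show ?thesis
    proof (cases "x' \<le> y2")
      case True
      then obtain v where "v \<le> y1" "\<And>z. G z v = x'" using x'(3) by blast
      then show ?thesis
        using marking_L'_fixed[of v "y - \<delta>" x'] x' y\<delta> yN by (intro exI[of _ v]) auto
    next
      case False
      then have "x' - \<delta> + \<delta> = x'" "y1 < x' - \<delta>" using \<delta> by auto
      then show ?thesis
        using marking_L'_right[of "x' - \<delta>" "y - \<delta>"] x' y\<delta> yN
        by (intro exI[of _ "x' - \<delta>"]) auto
    qed
  qed
  moreover have "pending L' x (N - \<delta>) = {}" if x: "x \<le> y - \<delta>" for x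
  proof (cases "x \<le> y1")
    case True
    then show ?thesis using pending_L'_top pend[of x] y y12 by simp
  next
    case False
    then show ?thesis
      using pending_L'_right[of x "N - \<delta>"] pend[of "x + \<delta>"] x yN \<delta> by auto
  qed
  moreover have "y - \<delta> + k_max \<phi> \<le> N - \<delta>" using yN y\<delta> by linarith
  ultimately show ?thesis
    using feat saturated_L' by (simp add: generator_at_def)
qed

text \<open>The cut starts at least \<open>k_max \<phi>\<close> rows above \<open>y\<close>, so row
  \<open>y\<close> with its representatives is untouched and the required distance to the new top
  remains.\<close>

lemma generator_at_L'_loop:
  assumes gen: "generator_at \<phi> L N y" and y: "y + k_max \<phi> \<le> y1"
    and feat: "features {0..N - \<delta>} L' \<phi>"
  shows "generator_at \<phi> L' (N - \<delta>) y"
proof -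
  have rep: "\<And>x. x \<le> N \<Longrightarrow> \<exists>x'\<le>y. marking \<phi> {0..N} L x' y = marking \<phi> {0..N} L x N"
    and pend: "\<And>x. x \<le> y \<Longrightarrow> pending L x N = {}"
    using gen by (auto simp: generator_at_def)
  have "\<exists>x'\<le>y. marking \<phi> {0..N - \<delta>} L' x' y = marking \<phi> {0..N - \<delta>} L' x (N - \<delta>)"
    if x: "x \<le> N - \<delta>" for x
  proof -
    have "col x (N - \<delta>) \<le> N" using col_le[of x "N - \<delta>"] x \<delta> y12 by auto
    then obtain x' where x': "x' \<le> y"
      "marking \<phi> {0..N} L x' y = marking \<phi> {0..N - \<delta>} L' x (N - \<delta>)"
      using rep marking_L'_top[OF x] by metis
    then show ?thesis using marking_L'_low[of x' y] y by auto
  qed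
  moreover have "pending L' x (N - \<delta>) = {}" if "x \<le> y" for x
    using that pending_L'_top[of x] pend[of x] y by simp
  moreover have "y + k_max \<phi> \<le> N - \<delta>" using y \<delta> y12 by linarith
  ultimately show ?thesis
    using feat saturated_L' by (simp add: generator_at_def)
qed

end

section \<open>Minimal generators\<close>

text \<open>\<open>j\<close> is the number of statuses that can occur: 3 for columns with nothing
  pending in the top row, as up to \<open>y_inf\<close>, and 4 in general.\<close>

definition ctypes :: "'p mpnl \<Rightarrow> nat \<Rightarrow> ('p mpnl set \<times> ('p mpnl \<Rightarrow> nat) \<times> nat) set" where
  "ctypes \<phi> j = atoms \<phi> \<times> (dia_r \<phi> \<rightarrow>\<^sub>E {..<j}) \<times> {..k_max \<phi>}"

lemma finite_ctypes [simp]: "finite (ctypes \<phi> j)"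
  by (simp add: ctypes_def finite_PiE)

lemma atoms_k_max_mult_power_le:
  assumes "1 \<le> j"
  shows "card (atoms \<phi>) * (j ^ card (dia_r \<phi>) * Suc (k_max \<phi>)) \<le> 2 ^ fm_length \<phi> * j ^ (fm_length \<phi> - 1)"
proof -
  have "card (atoms \<phi>) * (j ^ card (dia_r \<phi>) * Suc (k_max \<phi>))
    = card (atoms \<phi>) * Suc (k_max \<phi>) * j ^ card (dia_r \<phi>)" by (simp only: ac_simps)
  also have "\<dots> \<le> 2 ^ fm_length \<phi> * j ^ (fm_length \<phi> - 1)"
    using card_atoms_k_max_le card_dia_less_fm_length[of \<phi>] assms
    by (intro mult_le_mono power_increasing) auto
  finally show ?thesis .
qed

lemma card_ctypes_le:
  "1 \<le> j \<Longrightarrow> card (ctypes \<phi> j) \<le> 2 ^ fm_length \<phi> * j ^ (fm_length \<phi> - 1)"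
  using atoms_k_max_mult_power_le[of j \<phi>] by (simp add: ctypes_def card_cartesian_product card_PiE)

context saturated_compass
begin

lemma ctype_in_ctypes:
  assumes "x \<le> y" "y \<le> N"
  shows "ctype x y \<in> ctypes \<phi> 4"
  using label_in_atoms[OF assms] by (auto simp: ctype_def ctypes_def status_def)

lemma ctype_in_ctypes_fulfilled:
  assumes "x \<le> y" "y \<le> N" "pending L x N = {}"
  shows "ctype x y \<in> ctypes \<phi> 3"
  using label_in_atoms[OF assms(1,2)] assms(3) by (auto simp: ctype_def ctypes_def status_def)

lemma card_top_markings_le:
  "card ((\<lambda>x. marking \<phi> {0..N} L x N) ` {..N}) \<le> 2 ^ fm_length \<phi> * 2 ^ (fm_length \<phi> - 1)"
proof -
  have "(\<lambda>x. marking \<phi> {0..N} L x N) ` {..N} \<subseteq> atoms \<phi> \<times> Pow (dia_r \<phi>) \<times> {..k_max \<phi>}"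
    using label_in_atoms pending_subset_dia_r[of _ N, THEN subsetD] by (auto simp: marking_eq_pending)
  then have "card ((\<lambda>x. marking \<phi> {0..N} L x N) ` {..N})
    \<le> card (atoms \<phi> \<times> Pow (dia_r \<phi>) \<times> {..k_max \<phi>})"
    by (intro card_mono) auto
  also have "\<dots> = card (atoms \<phi>) * (2 ^ card (dia_r \<phi>) * Suc (k_max \<phi>))"
    by (simp add: card_cartesian_product card_Pow)
  also have "\<dots> \<le> 2 ^ fm_length \<phi> * 2 ^ (fm_length \<phi> - 1)"
    by (rule atoms_k_max_mult_power_le) simp
  finally show ?thesis .
qed

end

text \<open>The summands pay for the representatives of the top markings, for the witnesses as in
  \<open>ex_rerouting\<close>, and for the column \<open>x0\<close> of the featured point plus one
  unit of strictness.\<close>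

definition stem_cap :: "'p mpnl \<Rightarrow> nat" where
  "stem_cap \<phi> = 2 ^ fm_length \<phi> * 2 ^ (fm_length \<phi> - 1) + card (dia_l \<phi>) * (card (dia_r \<phi>) + 1) + 2"

definition loop_cap :: "'p mpnl \<Rightarrow> nat" where
  "loop_cap \<phi> = card (dia_l \<phi>) * (card (dia_r \<phi>) + 1) + 2"

lemma minimal_generator_size:
  assumes gen: "generator_at \<phi> L N y"
    and min: "\<And>L' N' y'. generator_at \<phi> L' N' y' \<Longrightarrow> N \<le> N'"
  shows "N + 1 \<le> 2 * (stem_cap \<phi> + 1) ^ card (ctypes \<phi> 3) + k_max \<phi>
    + 2 * (loop_cap \<phi> + 1) ^ card (ctypes \<phi> 4)"
proof -
  interpret saturated_compass \<phi> L N using gen by (simp add: generator_at_def)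
  have yN: "y + k_max \<phi> \<le> N"
    and rep: "\<And>x. x \<le> N \<Longrightarrow> \<exists>x'\<le>y. marking \<phi> {0..N} L x' y = marking \<phi> {0..N} L x N"
    and pend: "\<And>x. x \<le> y \<Longrightarrow> pending L x N = {}"
    and "features {0..N} L \<phi>"
    using gen by (auto simp: generator_at_def)
  then obtain x0 y0 where f: "x0 \<le> y0" "y0 \<le> N" "nf \<phi> \<in> L (x0, y0)"
    by (auto simp: features_def)
  have smaller: False
    if "contraction \<phi> L N y1 y2 G" "generator_at \<phi> L'' (N - contraction.\<delta> y1 y2) y''" for y1 y2 G L'' y''
    using contraction.\<delta>[OF that(1)] min[OF that(2)] by linarith
  define M where "M = (\<lambda>x. marking \<phi> {0..N} L x N) ` {..N}"
  have "\<forall>m\<in>M. \<exists>x'\<le>y. marking \<phi> {0..N} L x' y = m" using rep by (auto simp: M_def)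
  \<comment> \<open>One representative per top marking is fixed, so the cap depends on the number of
    markings and not on the number of columns.\<close>
  then obtain \<rho> where \<rho>: "\<And>m. m \<in> M \<Longrightarrow> \<rho> m \<le> y \<and> marking \<phi> {0..N} L (\<rho> m) y = m" by metis
  have finM: "finite M" by (simp add: M_def)

  have stem: "\<exists>\<tau>. min (stem_cap \<phi>) (card (cls y1 \<tau>)) \<noteq> min (stem_cap \<phi>) (card (cls y2 \<tau>))"
    if rows: "y1 < y2" "y2 < y" "y0 \<le> y1 \<or> y2 < y0" for y1 y2
  proof (rule ccontr)
    assume "\<nexists>\<tau>. min (stem_cap \<phi>) (card (cls y1 \<tau>)) \<noteq> min (stem_cap \<phi>) (card (cls y2 \<tau>))"
    then have eq: "min (stem_cap \<phi>) (card (cls y1 \<tau>)) = min (stem_cap \<phi>) (card (cls y2 \<tau>))" for \<tau>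
      by blast
    let ?W = "insert x0 (\<rho> ` M) \<inter> {..y2}"
    have "card ?W \<le> card (insert x0 (\<rho> ` M))" using finM by (intro card_mono) auto
    also have "\<dots> \<le> Suc (card M)"
      using finM card_image_le[OF finM, of \<rho>] by (simp add: card_insert_if)
    also have "\<dots> \<le> Suc (2 ^ fm_length \<phi> * 2 ^ (fm_length \<phi> - 1))"
      using card_top_markings_le by (simp add: M_def)
    finally have "card ?W + card (dia_l \<phi>) * (card (dia_r \<phi>) + 1) < stem_cap \<phi>"
      by (simp add: stem_cap_def)
    then obtain G where G: "contraction \<phi> L N y1 y2 G"
      "\<And>w. w \<in> ?W \<Longrightarrow> \<exists>x\<le>y1. \<forall>y. G y x = w"
      using ex_contraction[of y1 y2 ?W "stem_cap \<phi>"] eq rows yN by auto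
    interpret contraction \<phi> L N y1 y2 G by (rule G(1))
    have "features {0..N - \<delta>} L' \<phi>"
      using f rows(3) G(2) by (intro features_L'[of x0 y0]) auto
    moreover have "\<exists>x'\<le>y. marking \<phi> {0..N} L x' y = marking \<phi> {0..N} L x N
      \<and> (x' \<le> y2 \<longrightarrow> (\<exists>v\<le>y1. \<forall>z. G z v = x'))" if "x \<le> N" for x
      using \<rho>[of "marking \<phi> {0..N} L x N"] G(2) that
      by (intro exI[of _ "\<rho> (marking \<phi> {0..N} L x N)"]) (auto simp: M_def)
    ultimately have "generator_at \<phi> L' (N - \<delta>) (y - \<delta>)"
      using gen rows by (intro generator_at_L'_stem)
    then show False using smaller G(1) by blast
  qed

  have loop: "\<exists>\<tau>. min (loop_cap \<phi>) (card (cls y1 \<tau>)) \<noteq> min (loop_cap \<phi>) (card (cls y2 \<tau>))"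
    if rows: "y1 < y2" "y2 \<le> N" "y + k_max \<phi> \<le> y1" "y0 \<le> y1 \<or> y2 < y0" for y1 y2
  proof (rule ccontr)
    assume "\<nexists>\<tau>. min (loop_cap \<phi>) (card (cls y1 \<tau>)) \<noteq> min (loop_cap \<phi>) (card (cls y2 \<tau>))"
    then have eq: "min (loop_cap \<phi>) (card (cls y1 \<tau>)) = min (loop_cap \<phi>) (card (cls y2 \<tau>))" for \<tau>
      by blast
    let ?W = "{x0} \<inter> {..y2}"
    have "card ?W \<le> card {x0}" by (intro card_mono) auto
    then have "card ?W + card (dia_l \<phi>) * (card (dia_r \<phi>) + 1) < loop_cap \<phi>"
      by (simp add: loop_cap_def)
    then obtain G where G: "contraction \<phi> L N y1 y2 G"
      "\<And>w. w \<in> ?W \<Longrightarrow> \<exists>x\<le>y1. \<forall>y. G y x = w"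
      using ex_contraction[of y1 y2 ?W "loop_cap \<phi>"] eq rows by auto
    interpret contraction \<phi> L N y1 y2 G by (rule G(1))
    have "features {0..N - \<delta>} L' \<phi>"
      using f rows(4) G(2) by (intro features_L'[of x0 y0]) auto
    then have "generator_at \<phi> L' (N - \<delta>) y"
      using gen rows by (intro generator_at_L'_loop)
    then show False using smaller G(1) by blast
  qed

  let ?X = "(stem_cap \<phi> + 1) ^ card (ctypes \<phi> 3)"
  let ?Y = "(loop_cap \<phi> + 1) ^ card (ctypes \<phi> 4)"
  have stem_rows: "card R \<le> ?X" if R: "R \<subseteq> {..<y}" "R \<subseteq> {..<y0} \<or> R \<subseteq> {y0..}" for R
  proof (rule card_rows_le)
    show "ctype x z \<in> ctypes \<phi> 3" if "z \<in> R" "x \<le> z" for x z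
      using R(1) that yN pend by (intro ctype_in_ctypes_fulfilled) force+
    show "\<exists>\<tau>. min (stem_cap \<phi>) (card (cls y1 \<tau>)) \<noteq> min (stem_cap \<phi>) (card (cls y2 \<tau>))"
      if "y1 \<in> R" "y2 \<in> R" "y1 < y2" for y1 y2
      using R that by (intro stem) auto
  qed simp
  have loop_rows: "card R \<le> ?Y"
    if R: "R \<subseteq> {y + k_max \<phi>..N}" "R \<subseteq> {..<y0} \<or> R \<subseteq> {y0..}" for R
  proof (rule card_rows_le)
    show "ctype x z \<in> ctypes \<phi> 4" if "z \<in> R" "x \<le> z" for x z
      using R(1) that by (intro ctype_in_ctypes) auto
    show "\<exists>\<tau>. min (loop_cap \<phi>) (card (cls y1 \<tau>)) \<noteq> min (loop_cap \<phi>) (card (cls y2 \<tau>))"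
      if "y1 \<in> R" "y2 \<in> R" "y1 < y2" for y1 y2
      using R that by (intro loop) auto
  qed simp
  \<comment> \<open>The rows are split at \<open>y\<close>, at \<open>y + k_max \<phi>\<close> and
    at \<open>y0\<close>; the last split keeps the featured row out of every cut. The
    \<open>k_max \<phi>\<close> rows of \<open>?C\<close> are counted outright.\<close>
  let ?A = "{..<y} \<inter> {..<y0}" and ?B = "{..<y} \<inter> {y0..}" and ?C = "{y..<y + k_max \<phi>}"
  let ?D = "{y + k_max \<phi>..N} \<inter> {..<y0}" and ?E = "{y + k_max \<phi>..N} \<inter> {y0..}"
  have "{..N} \<subseteq> (?A \<union> ?B) \<union> ?C \<union> (?D \<union> ?E)" by auto
  then have "card {..N} \<le> card ((?A \<union> ?B) \<union> ?C \<union> (?D \<union> ?E))"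
    by (intro card_mono) auto
  also have "\<dots> \<le> (card ?A + card ?B) + card ?C + (card ?D + card ?E)"
    by (intro order_trans[OF card_Un_le] add_mono card_Un_le order_refl)
  also have "\<dots> \<le> (?X + ?X) + k_max \<phi> + (?Y + ?Y)"
    by (intro add_mono stem_rows loop_rows) auto
  finally show ?thesis by simp
qed

section \<open>Numerical estimates\<close>

text \<open>This absorbs the exponent \<open>n + 3\<close> of \<open>stem_base_le\<close>: having
  three statuses instead of four compensates for the larger cap.\<close>

lemma power_4_ge: "1 \<le> n \<Longrightarrow> (n + 3) * 3 ^ (n - 1) \<le> (4::nat) ^ n"
proof (induction n rule: dec_induct)
  case (step n)
  have "(Suc n + 3) * 3 ^ (Suc n - 1) = (3 * n + 12) * 3 ^ (n - 1)"
    using step(1) by (cases n) auto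
  also have "\<dots> \<le> 4 * ((n + 3) * 3 ^ (n - 1))" by (simp add: algebra_simps)
  also have "\<dots> \<le> 4 ^ Suc n" using step by simp
  finally show ?case .
qed simp

text \<open>Arithmetic-geometric mean inequality for \<open>card (dia_l \<phi>)\<close> and
  \<open>card (dia_r \<phi>) + 1\<close>, whose sum is at most \<open>fm_length \<phi>\<close> by
  the strict count of diamonds.\<close>

lemma dia_product_le: "real (card (dia_l \<phi>) * (card (dia_r \<phi>) + 1)) \<le> (real (fm_length \<phi>))\<^sup>2 / 4"
proof -
  let ?l = "real (card (dia_l \<phi>))" and ?r = "real (card (dia_r \<phi>)) + 1"
  have "4 * (?l * ?r) \<le> (?l + ?r)\<^sup>2"
    using zero_le_power2[of "?l - ?r"] by (simp add: power2_eq_square algebra_simps)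
  also have "\<dots> \<le> (real (fm_length \<phi>))\<^sup>2"
    using card_dia_less_fm_length[of \<phi>] by (intro power_mono) auto
  finally show ?thesis by (simp add: algebra_simps)
qed

text \<open>The number of representatives makes the left side exponential, so the base is raised to
  a power growing with \<open>n\<close>. From \<open>n = 3\<close> on the base is at least 4 and
  comparison with powers of 4 suffices; smaller \<open>n\<close> are evaluated.\<close>

lemma stem_base_le:
  fixes n :: nat
  assumes "1 \<le> n"
  shows "2 ^ n * 2 ^ (n - 1) + (real n)\<^sup>2 / 4 + 3 \<le> ((real n)\<^sup>2 / 4 + real n / 2 + 1) ^ (n + 3)"
proof -
  consider "n = 1" | "n = 2" | "3 \<le> n" using assms by linarith
  then show ?thesis
  proof cases
    case 3
    let ?b = "(real n)\<^sup>2 / 4 + real n / 2 + 1"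
    have "(3::real)\<^sup>2 \<le> (real n)\<^sup>2" using 3 by (intro power_mono) auto
    then have b: "4 \<le> ?b" using 3 by (simp add: power2_eq_square)
    have two: "2 ^ n * 2 ^ (n - 1) = (4::real) ^ n / 2"
      using assms by (cases n) (auto simp: power_mult_distrib[symmetric])
    have "(real n)\<^sup>2 \<le> (2 ^ n)\<^sup>2"
      by (intro power_mono) (auto simp: less_imp_le)
    also have "\<dots> = (4::real) ^ n" by (simp add: power2_eq_square power_mult_distrib[symmetric])
    finally have "2 ^ n * 2 ^ (n - 1) + (real n)\<^sup>2 / 4 + 3 \<le> 4 ^ n / 2 + 4 ^ n / 4 + 3 * (4::real) ^ n"
      using two one_le_power[of "4::real" n] by linarith
    also have "\<dots> \<le> 4 ^ (n + 3)" by (simp add: power_add)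
    also have "\<dots> \<le> ?b ^ (n + 3)" using b by (intro power_mono) auto
    finally show ?thesis .
  qed (simp_all add: eval_nat_numeral)
qed

lemma stem_rows_le:
  fixes \<phi> :: "'p mpnl"
  defines "n \<equiv> fm_length \<phi>"
  defines "b \<equiv> (real n)\<^sup>2 / 4 + real n / 2 + 1"
  shows "real ((stem_cap \<phi> + 1) ^ card (ctypes \<phi> 3)) \<le> b ^ (2 ^ (3 * n))"
proof -
  have n: "1 \<le> n" using card_dia_less_fm_length[of \<phi>] by (simp add: n_def)
  have b: "1 \<le> b" by (simp add: b_def)
  have "real (stem_cap \<phi> + 1) \<le> 2 ^ n * 2 ^ (n - 1) + (real n)\<^sup>2 / 4 + 3"
    using dia_product_le[of \<phi>] by (simp add: stem_cap_def n_def)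
  also have "\<dots> \<le> b ^ (n + 3)" unfolding b_def by (rule stem_base_le[OF n])
  finally have base: "real (stem_cap \<phi> + 1) \<le> b ^ (n + 3)" .
  have "(n + 3) * card (ctypes \<phi> 3) \<le> (n + 3) * (2 ^ n * 3 ^ (n - 1))"
    using card_ctypes_le[of 3 \<phi>] by (intro mult_le_mono) (auto simp: n_def)
  also have "\<dots> = 2 ^ n * ((n + 3) * 3 ^ (n - 1))" by (simp only: ac_simps)
  also have "\<dots> \<le> 2 ^ n * 4 ^ n" using power_4_ge[OF n] by (intro mult_le_mono) auto
  also have "\<dots> = 2 ^ (3 * n)" by (simp add: power_mult power_mult_distrib[symmetric])
  finally have ex: "(n + 3) * card (ctypes \<phi> 3) \<le> 2 ^ (3 * n)" .
  have "real ((stem_cap \<phi> + 1) ^ card (ctypes \<phi> 3)) = real (stem_cap \<phi> + 1) ^ card (ctypes \<phi> 3)"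
    by (rule of_nat_power)
  also have "\<dots> \<le> (b ^ (n + 3)) ^ card (ctypes \<phi> 3)" using base by (intro power_mono) auto
  also have "\<dots> = b ^ ((n + 3) * card (ctypes \<phi> 3))" by (simp only: power_mult)
  also have "\<dots> \<le> b ^ (2 ^ (3 * n))" using ex b by (rule power_increasing)
  finally show ?thesis .
qed

text \<open>Here the cap is only quadratic, so a fixed fourth power of the base covers it, and the
  factor 4 in the exponent turns \<open>4 ^ (n - 1)\<close> into exactly
  \<open>4 ^ n\<close>.\<close>

lemma loop_rows_le:
  fixes \<phi> :: "'p mpnl"
  defines "n \<equiv> fm_length \<phi>"
  defines "b \<equiv> (real n)\<^sup>2 / 4 + real n / 2 + 1"
  shows "real ((loop_cap \<phi> + 1) ^ card (ctypes \<phi> 4)) \<le> b ^ (2 ^ (3 * n))"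
proof -
  have n: "1 \<le> n" using card_dia_less_fm_length[of \<phi>] by (simp add: n_def)
  have b: "1 \<le> b" by (simp add: b_def)
  have "1 \<le> real n" using n by simp
  have "real (loop_cap \<phi> + 1) \<le> (real n)\<^sup>2 / 4 + 3"
    using dia_product_le[of \<phi>] by (simp add: loop_cap_def n_def)
  also have "\<dots> \<le> 1 + real 4 * (b - 1)"
    unfolding b_def of_nat_numeral using \<open>1 \<le> real n\<close> zero_le_power2[of "real n"] by argo
  also have "\<dots> \<le> (1 + (b - 1)) ^ 4" using b by (intro Bernoulli_inequality) auto
  finally have base: "real (loop_cap \<phi> + 1) \<le> b ^ 4" by simp
  have "4 * card (ctypes \<phi> 4) \<le> 4 * (2 ^ n * 4 ^ (n - 1))"
    using card_ctypes_le[of 4 \<phi>] by (intro mult_le_mono) (auto simp: n_def)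
  also have "\<dots> = 2 ^ n * 4 ^ n" using n by (cases n) auto
  also have "\<dots> = 2 ^ (3 * n)" by (simp add: power_mult power_mult_distrib[symmetric])
  finally have ex: "4 * card (ctypes \<phi> 4) \<le> 2 ^ (3 * n)" .
  have "real ((loop_cap \<phi> + 1) ^ card (ctypes \<phi> 4)) = real (loop_cap \<phi> + 1) ^ card (ctypes \<phi> 4)"
    by (rule of_nat_power)
  also have "\<dots> \<le> (b ^ 4) ^ card (ctypes \<phi> 4)" using base by (intro power_mono) auto
  also have "\<dots> = b ^ (4 * card (ctypes \<phi> 4))" by (simp only: power_mult)
  also have "\<dots> \<le> b ^ (2 ^ (3 * n))" using ex b by (rule power_increasing)
  finally show ?thesis .
qed

lemma k_max_le_power: "k_max \<phi> \<le> 2 ^ fm_length \<phi>"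
proof -
  obtain j where "card (subfms \<phi>) + j \<le> fm_length \<phi>" "k_max \<phi> < 2 ^ j"
    using k_max_less_power by blast
  then show ?thesis
    using power_increasing[of j "fm_length \<phi>" "2::nat"] by linarith
qed

theorem theorem3:
  fixes \<phi> :: "'p mpnl"
  assumes "\<exists>D L. N_compass_generator \<phi> D L \<and> features D L \<phi>"
  shows "\<exists>D' L'. N_compass_generator \<phi> D' L' \<and> features D' L' \<phi> \<and>
    real (card D') \<le>
      (2 ^ (3 * fm_length \<phi>) + 2) *
      ((real (fm_length \<phi>))\<^sup>2 / 4 + real (fm_length \<phi>) / 2 + 1) ^ (2 ^ (3 * fm_length \<phi>)) + 1"
proof -
  \<comment> \<open>The minimum ranges over all labellings and all choices of \<open>y_inf\<close>,
    since a contraction may change both.\<close>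
  define N where "N = (LEAST N. \<exists>L y. generator_at \<phi> L N y)"
  have ex: "\<exists>N L y. generator_at \<phi> L N y"
    using assms by (auto simp: N_compass_generator_iff)
  then have "\<exists>L y. generator_at \<phi> L N y" unfolding N_def by (rule LeastI_ex)
  then obtain L y where gen: "generator_at \<phi> L N y" by blast
  have "N \<le> N'" if "generator_at \<phi> L' N' y'" for L' N' y'
    unfolding N_def using that by (intro Least_le) blast
  then have size: "N + 1 \<le> 2 * (stem_cap \<phi> + 1) ^ card (ctypes \<phi> 3) + k_max \<phi>
    + 2 * (loop_cap \<phi> + 1) ^ card (ctypes \<phi> 4)"
    using minimal_generator_size[OF gen] by blast
  define n where "n = fm_length \<phi>"
  define B where "B = ((real n)\<^sup>2 / 4 + real n / 2 + 1) ^ (2 ^ (3 * n))"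
  have n: "1 \<le> n" using card_dia_less_fm_length[of \<phi>] by (simp add: n_def)
  have B: "1 \<le> B" unfolding B_def by (intro one_le_power) simp
  have "real (N + 1) \<le> real (2 * (stem_cap \<phi> + 1) ^ card (ctypes \<phi> 3) + k_max \<phi>
    + 2 * (loop_cap \<phi> + 1) ^ card (ctypes \<phi> 4))"
    using size by (rule of_nat_mono)
  also have "\<dots> = 2 * real ((stem_cap \<phi> + 1) ^ card (ctypes \<phi> 3)) + real (k_max \<phi>)
    + 2 * real ((loop_cap \<phi> + 1) ^ card (ctypes \<phi> 4))"
    by (simp only: of_nat_add of_nat_mult of_nat_numeral)
  also have "\<dots> \<le> 2 * B + 2 ^ n + 2 * B"
  proof -
    have "real (k_max \<phi>) \<le> 2 ^ n"
      using of_nat_mono[OF k_max_le_power[of \<phi>], where 'a = real] by (simp add: n_def)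
    then show ?thesis
      using stem_rows_le[of \<phi>] loop_rows_le[of \<phi>] unfolding B_def n_def by linarith
  qed
  \<comment> \<open>The middle block contributes at most \<open>2 ^ n\<close> rows, and
    \<open>B \<ge> 1\<close> turns them into a multiple of \<open>B\<close>; what remains is
    \<open>2 ^ n + 4 \<le> 2 ^ (3 * n) + 2\<close> for \<open>n \<ge> 1\<close>.\<close>
  also have "\<dots> \<le> 2 * B + 2 ^ n * B + 2 * B" using B by simp
  also have "\<dots> = (2 ^ n + 2 + 2) * B" by (simp add: algebra_simps)
  also have "\<dots> \<le> (2 ^ (3 * n) + 2) * B"
  proof (intro mult_right_mono)
    have "(2::real) ^ 1 \<le> 2 ^ n" using n by (intro power_increasing) auto
    then have "2 ^ n + 2 \<le> 2 ^ n * (2::real) ^ 1" by simp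
    also have "\<dots> = 2 ^ (n + 1)" by simp
    also have "\<dots> \<le> 2 ^ (3 * n)" using n by (intro power_increasing) auto
    finally show "2 ^ n + 2 + 2 \<le> 2 ^ (3 * n) + (2::real)" by simp
  qed (use B in simp)
  finally have "real (card {0..N}) \<le> (2 ^ (3 * n) + 2) * B + 1" by simp
  moreover have "N_compass_generator \<phi> {0..N} L" "features {0..N} L \<phi>"
    using gen by (auto simp: N_compass_generator_iff generator_at_def)
  ultimately show ?thesis unfolding B_def n_def by blast
qed

end
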